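(* Let $0<C\le1$, let $\{\eta_k\}_{k\in I_{MZ}}$ be an $L_2$-orthonormal basis of a finite-dimensional function space $V$ on $D$, and let $X_{MZ}=\{x^1,\dots,x^M\}\subset D$ be points and $\omega_1,\dots,\omega_M\ge0$ weights satisfying an $L_2$-MZ inequality for $V$ with constants $0<A\le B<\infty$, i.e. $A\|f\|_{L_2}^2\le\sum_{i=1}^M\omega_i|f(x^i)|^2\le B\|f\|_{L_2}^2$ for all $f\in V$. Let $t>0$, $\emptyset\ne I\subset I_{MZ}$ and $n\in\mathbb N$ with $$n\ge\frac{12B}{AC}|I|(\log|I|+t).$$ Let $\varrho_1,\dots,\varrho_M\ge0$ with $\sum_{i=1}^M\varrho_i=1$ be probability weights satisfying $$\varrho_i\ge\frac{C\,\omega_i\sum_{k\in I}|\eta_k(x^i)|^2}{\sum_{j=1}^M\omega_j\sum_{k\in I}|\eta_k(x^j)|^2}\qquad(i=1,\dots,M),$$ and draw indices $J=(j_1,\dots,j_n)$ i.i.d. from $\{1,\dots,M\}$ according to $(\varrho_i)$ (duplicates allowed). Then with probability larger than $1-2\exp(-t)$, $$\frac12A\|f\|_{L_2}^2\le\sum_{i\in J}\frac{\omega_i}{n\varrho_i}|f(x^i)|^2\le\frac32B\|f\|_{L_2}^2\qquad\text{for all }f\in\operatorname{span}\{\eta_k\}_{k\in I}.$$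
   Context: $D\subset\mathbb R^d$ carries a $\sigma$-finite measure $\nu$; $L_2=L_2(D,\nu)$ is the space of complex-valued square-integrable functions with $\langle f,g\rangle_{L_2}=\int_D f\overline g\,d\nu$. Elements of $V$ are functions with well-defined point values. $\log$ is the natural logarithm. Sums over $i\in J$ count repeated indices with multiplicity. *)

theory Defs
  imports "HOL-Probability.Probability" "HOL-Library.Function_Algebras"
begin

text \<open>Functions into \<open>complex\<close> as a complex vector space with pointwise operations. This makes
  \<open>cfun.span\<close>, \<open>cfun.subspace\<close> and \<open>cfun.independent\<close> (library notions) available.\<close>

global_interpretation cfun: vector_space "\<lambda>(c::complex) (f::'a \<Rightarrow> complex) x. c * f x"
  by unfold_locales (auto simp: fun_eq_iff algebra_simps)

text \<open>A function on \<open>D\<close> is encoded by its extension by zero. Elements are functions, not classes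
  modulo null sets, so that point values make sense.\<close>

definition functions_on :: "'a set \<Rightarrow> ('a \<Rightarrow> complex) set" where
  "functions_on D = {f. \<forall>x. x \<notin> D \<longrightarrow> f x = 0}"

definition square_integrable :: "'a measure \<Rightarrow> ('a \<Rightarrow> complex) \<Rightarrow> bool" where
  "square_integrable \<nu> f \<longleftrightarrow>
     f \<in> borel_measurable \<nu> \<and> integrable \<nu> (\<lambda>x. (cmod (f x))\<^sup>2)"

definition L2_inner :: "'a measure \<Rightarrow> ('a \<Rightarrow> complex) \<Rightarrow> ('a \<Rightarrow> complex) \<Rightarrow> complex" where
  "L2_inner \<nu> f g = (LINT x|\<nu>. f x * cnj (g x))"

definition L2_norm :: "'a measure \<Rightarrow> ('a \<Rightarrow> complex) \<Rightarrow> real" where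
  "L2_norm \<nu> f = sqrt (LINT x|\<nu>. (cmod (f x))\<^sup>2)"

definition finite_dim_L2_space :: "'a measure \<Rightarrow> ('a \<Rightarrow> complex) set \<Rightarrow> bool" where
  "finite_dim_L2_space \<nu> V \<longleftrightarrow>
     cfun.subspace V \<and> (\<exists>S. finite S \<and> cfun.span S = V) \<and>
     V \<subseteq> functions_on (space \<nu>) \<and> (\<forall>f\<in>V. square_integrable \<nu> f)"

definition L2_orthonormal_basis ::
    "'a measure \<Rightarrow> ('a \<Rightarrow> complex) set \<Rightarrow> 'k set \<Rightarrow> ('k \<Rightarrow> 'a \<Rightarrow> complex) \<Rightarrow> bool" where
  "L2_orthonormal_basis \<nu> V K \<eta> \<longleftrightarrow>
     inj_on \<eta> K \<and> cfun.independent (\<eta> ` K) \<and> cfun.span (\<eta> ` K) = V \<and>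
     (\<forall>k\<in>K. \<forall>l\<in>K. L2_inner \<nu> (\<eta> k) (\<eta> l) = (if k = l then 1 else 0))"

definition L2_MZ_inequality ::
    "'a measure \<Rightarrow> ('a \<Rightarrow> complex) set \<Rightarrow> nat \<Rightarrow> (nat \<Rightarrow> 'a) \<Rightarrow> (nat \<Rightarrow> real) \<Rightarrow> real \<Rightarrow> real \<Rightarrow> bool"
  where
  "L2_MZ_inequality \<nu> V M x \<omega> A B \<longleftrightarrow>
     (\<forall>f\<in>V. A * (L2_norm \<nu> f)\<^sup>2 \<le> (\<Sum>i=1..M. \<omega> i * (cmod (f (x i)))\<^sup>2) \<and>
            (\<Sum>i=1..M. \<omega> i * (cmod (f (x i)))\<^sup>2) \<le> B * (L2_norm \<nu> f)\<^sup>2)"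

text \<open>\<open>J\<^sub>1, \<dots>, J\<^sub>n\<close> are independent random indices with values in \<open>{1..M}\<close>, each with
  distribution \<open>\<rho>\<close>.\<close>

definition iid_indices ::
    "'w measure \<Rightarrow> nat \<Rightarrow> nat \<Rightarrow> (nat \<Rightarrow> real) \<Rightarrow> (nat \<Rightarrow> 'w \<Rightarrow> nat) \<Rightarrow> bool" where
  "iid_indices P n M \<rho> J \<longleftrightarrow>
     prob_space P \<and>
     prob_space.indep_vars P (\<lambda>_. count_space {1..M}) J {1..n} \<and>
     (\<forall>l\<in>{1..n}. \<forall>i\<in>{1..M}. measure P {w \<in> space P. J l w = i} = \<rho> i)"

text \<open>The subsampled quadratic form; summing over the draws counts repeated indices with
  multiplicity. Indices with \<open>\<rho> i = 0\<close> contribute \<open>0\<close> by the convention \<open>a / 0 = 0\<close>, but are drawn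
  with probability zero.\<close>

definition subsampled_sum ::
    "nat \<Rightarrow> (nat \<Rightarrow> 'a) \<Rightarrow> (nat \<Rightarrow> real) \<Rightarrow> (nat \<Rightarrow> real) \<Rightarrow> (nat \<Rightarrow> nat) \<Rightarrow> ('a \<Rightarrow> complex) \<Rightarrow> real" where
  "subsampled_sum n x \<omega> \<rho> j f =
     (\<Sum>l=1..n. \<omega> (j l) / (real n * \<rho> (j l)) * (cmod (f (x (j l))))\<^sup>2)"

end

theory Submission
  imports Defs
begin

text \<open>The coefficient vector of \<open>f = \<Sum>k\<in>I. c k * \<eta> k\<close> satisfies \<open>\<parallel>f\<parallel>\<^sup>2 = \<parallel>c\<parallel>\<^sup>2\<close> and
\<open>f (x i) = \<langle>c, y\<^sub>i\<rangle>\<close> with \<open>y\<^sub>i k = cnj (\<eta> k (x i))\<close>. The claim therefore says that the random positive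
semidefinite matrix \<open>S = \<Sum>l. \<omega> / (n \<rho>) y y\<^sup>*\<close>, a sum of \<open>n\<close> independent rank-one matrices, has its
spectrum in \<open>[A/2, 3B/2]\<close>. Its expectation has spectrum in \<open>[A, B]\<close> by the MZ inequality, and the lower
bound on \<open>\<rho>\<close> makes every summand at most \<open>B |I| / (n C)\<close>. So the theorem is a matrix Chernoff bound, whose
dimensional factor \<open>|I|\<close> is the reason for \<open>ln |I|\<close> in the hypothesis on \<open>n\<close>.

As usual for such bounds one controls \<open>E tr (exp (\<sigma> S))\<close> for a sign \<open>\<sigma> = \<plusminus>1\<close>, one summand at a time. The step
is the case of the Golden--Thompson inequality for a rank-one update by a unit vector \<open>v\<close>:
\<open>tr (exp (m + s v v\<^sup>*)) \<le> tr (exp m) + (exp s - 1) \<langle>exp m v, v\<rangle>\<close> whenever \<open>m\<close> and \<open>m + s v v\<^sup>*\<close> are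
positive semidefinite. Indeed, put \<open>h s = \<langle>exp (m + s v v\<^sup>*) v, v\<rangle>\<close>. The derivative of the left-hand side is \<open>h\<close>,
and \<open>h' \<le> h\<close>, because the derivative of \<open>\<langle>m\<^sup>p v, v\<rangle>\<close> is a sum of \<open>p\<close> products
\<open>\<langle>m\<^sup>a v, v\<rangle> \<langle>m\<^sup>b v, v\<rangle>\<close> with \<open>a + b = p - 1\<close>, each at most \<open>\<langle>m\<^bsup>p - 1\<^esup> v, v\<rangle>\<close> by log-convexity of moments.
Both signs of \<open>s\<close> are covered, provided positivity holds along the way; the shift by
\<open>K = n r\<close> in \<open>shifted_gram\<close> ensures this, and it cancels in the end.

Averaging over the random vector turns \<open>\<langle>exp m y, y\<rangle>\<close> into the trace of \<open>exp m\<close> times the expected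
summand. It is bounded by the MZ inequality after writing \<open>exp m\<close> as the square of \<open>exp (m / 2)\<close>
(\<open>exp_form_square_root\<close>). Iteration and Markov's inequality give \<open>matrix_Chernoff_rank1\<close>, and the
theorem applies it once with each sign.\<close>

section \<open>Vectors and matrices over a finite index set\<close>

text \<open>Vectors and matrices are functions on the whole index type, of which only the entries in \<open>I\<close> matter:
the dimension is the cardinality of a set here, not of a type.\<close>

definition ip :: "'k set \<Rightarrow> ('k \<Rightarrow> complex) \<Rightarrow> ('k \<Rightarrow> complex) \<Rightarrow> complex" where
  "ip I a b = (\<Sum>k\<in>I. a k * cnj (b k))"

definition sqnorm :: "'k set \<Rightarrow> ('k \<Rightarrow> complex) \<Rightarrow> real" where
  "sqnorm I a = (\<Sum>k\<in>I. (cmod (a k))\<^sup>2)"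

definition mat_vec :: "'k set \<Rightarrow> ('k \<Rightarrow> 'k \<Rightarrow> complex) \<Rightarrow> ('k \<Rightarrow> complex) \<Rightarrow> 'k \<Rightarrow> complex" where
  "mat_vec I m c = (\<lambda>k. \<Sum>j\<in>I. m k j * c j)"

definition unit_vec :: "'k \<Rightarrow> 'k \<Rightarrow> complex" where
  "unit_vec k = (\<lambda>j. if j = k then 1 else 0)"

definition hermitian :: "'k set \<Rightarrow> ('k \<Rightarrow> 'k \<Rightarrow> complex) \<Rightarrow> bool" where
  "hermitian I m \<longleftrightarrow> (\<forall>k\<in>I. \<forall>j\<in>I. m k j = cnj (m j k))"

definition psd :: "'k set \<Rightarrow> ('k \<Rightarrow> 'k \<Rightarrow> complex) \<Rightarrow> bool" where
  "psd I m \<longleftrightarrow> hermitian I m \<and> (\<forall>c. 0 \<le> Re (ip I (mat_vec I m c) c))"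

definition add_rank1 ::
    "('k \<Rightarrow> 'k \<Rightarrow> complex) \<Rightarrow> real \<Rightarrow> ('k \<Rightarrow> complex) \<Rightarrow> 'k \<Rightarrow> 'k \<Rightarrow> complex" where
  "add_rank1 m s v = (\<lambda>k j. m k j + of_real s * v k * cnj (v j))"

definition moment :: "'k set \<Rightarrow> ('k \<Rightarrow> 'k \<Rightarrow> complex) \<Rightarrow> nat \<Rightarrow> ('k \<Rightarrow> complex) \<Rightarrow> real" where
  "moment I m p v = Re (ip I ((mat_vec I m ^^ p) v) v)"

text \<open>The quadratic form \<open>\<langle>exp m v, v\<rangle>\<close> of the matrix exponential.\<close>

definition exp_form :: "'k set \<Rightarrow> ('k \<Rightarrow> 'k \<Rightarrow> complex) \<Rightarrow> ('k \<Rightarrow> complex) \<Rightarrow> real" where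
  "exp_form I m v = (\<Sum>p. moment I m p v / fact p)"

definition trace_exp :: "'k set \<Rightarrow> ('k \<Rightarrow> 'k \<Rightarrow> complex) \<Rightarrow> real" where
  "trace_exp I m = (\<Sum>k\<in>I. exp_form I m (unit_vec k))"

lemma ip_self: "ip I a a = of_real (sqnorm I a)"
  by (simp add: ip_def sqnorm_def complex_norm_square[symmetric])

lemma cnj_ip: "cnj (ip I a b) = ip I b a"
  by (simp add: ip_def mult.commute)

lemma ip_add_left: "ip I (\<lambda>k. a k + b k) c = ip I a c + ip I b c"
  and ip_add_right: "ip I c (\<lambda>k. a k + b k) = ip I c a + ip I c b"
  and ip_scale_left: "ip I (\<lambda>k. z * a k) c = z * ip I a c"
  and ip_scale_right: "ip I c (\<lambda>k. z * a k) = cnj z * ip I c a"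
  by (simp_all add: ip_def algebra_simps sum.distrib sum_distrib_left)

lemma ip_sum_left: "ip I (\<lambda>k. \<Sum>l\<in>L. f l k) c = (\<Sum>l\<in>L. ip I (f l) c)"
  unfolding ip_def by (simp add: sum_distrib_right) (rule sum.swap)

lemma ip_cong: "(\<And>k. k \<in> I \<Longrightarrow> a k = a' k) \<Longrightarrow> (\<And>k. k \<in> I \<Longrightarrow> b k = b' k) \<Longrightarrow> ip I a b = ip I a' b'"
  by (simp add: ip_def)

lemma sqnorm_nonneg: "0 \<le> sqnorm I a"
  by (simp add: sqnorm_def sum_nonneg)

lemma sqnorm_scale: "sqnorm I (\<lambda>k. z * a k) = (cmod z)\<^sup>2 * sqnorm I a"
  by (simp add: sqnorm_def norm_mult power_mult_distrib sum_distrib_left)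

lemma sqnorm_eq_0: "finite I \<Longrightarrow> sqnorm I a = 0 \<longleftrightarrow> (\<forall>k\<in>I. a k = 0)"
  by (simp add: sqnorm_def sum_nonneg_eq_0_iff)

lemma sqnorm_unit_vec: "finite I \<Longrightarrow> k \<in> I \<Longrightarrow> sqnorm I (unit_vec k) = 1"
  unfolding sqnorm_def unit_vec_def by (subst sum.remove[of _ k]) (auto intro!: sum.neutral)

lemma ip_unit_vec_right: "finite I \<Longrightarrow> k \<in> I \<Longrightarrow> ip I a (unit_vec k) = a k"
  unfolding ip_def unit_vec_def by (subst sum.remove[of _ k]) (auto intro!: sum.neutral)

lemma ip_unit_vec_left: "finite I \<Longrightarrow> k \<in> I \<Longrightarrow> ip I (unit_vec k) a = cnj (a k)"
  by (metis cnj_ip ip_unit_vec_right)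

lemma ip_Cauchy_Schwarz: "(cmod (ip I a b))\<^sup>2 \<le> sqnorm I a * sqnorm I b"
proof -
  have "cmod (ip I a b) \<le> (\<Sum>k\<in>I. cmod (a k) * cmod (b k))"
    unfolding ip_def by (rule order_trans[OF norm_sum]) (simp add: norm_mult)
  then have "(cmod (ip I a b))\<^sup>2 \<le> (\<Sum>k\<in>I. cmod (a k) * cmod (b k))\<^sup>2"
    by (rule power_mono) simp
  also have "\<dots> \<le> sqnorm I a * sqnorm I b"
    unfolding sqnorm_def by (rule Cauchy_Schwarz_ineq_sum)
  finally show ?thesis .
qed

lemma mat_vec_add: "mat_vec I m (\<lambda>k. a k + b k) = (\<lambda>k. mat_vec I m a k + mat_vec I m b k)"
  and mat_vec_scale: "mat_vec I m (\<lambda>k. z * a k) = (\<lambda>k. z * mat_vec I m a k)"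
  by (simp_all add: mat_vec_def fun_eq_iff algebra_simps sum.distrib sum_distrib_left)

lemma mat_vec_sum: "mat_vec I m (\<lambda>k. \<Sum>l\<in>L. f l k) = (\<lambda>k. \<Sum>l\<in>L. mat_vec I m (f l) k)"
  unfolding mat_vec_def by (rule ext) (simp add: sum_distrib_left, rule sum.swap)

lemma mat_vec_pow_add: "(mat_vec I m ^^ p) (\<lambda>k. a k + b k) = (\<lambda>k. (mat_vec I m ^^ p) a k + (mat_vec I m ^^ p) b k)"
  and mat_vec_pow_scale: "(mat_vec I m ^^ p) (\<lambda>k. z * a k) = (\<lambda>k. z * (mat_vec I m ^^ p) a k)"
  by (induction p) (simp_all add: mat_vec_add mat_vec_scale)

lemma mat_vec_add_rank1: "mat_vec I (add_rank1 m s v) c = (\<lambda>k. mat_vec I m c k + of_real s * ip I c v * v k)"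
  by (simp add: mat_vec_def add_rank1_def ip_def fun_eq_iff algebra_simps sum.distrib sum_distrib_left)

lemma hermitian_add_rank1: "hermitian I m \<Longrightarrow> hermitian I (add_rank1 m s v)"
  unfolding hermitian_def
proof (intro ballI)
  fix k j assume "\<forall>k\<in>I. \<forall>j\<in>I. m k j = cnj (m j k)" "k \<in> I" "j \<in> I"
  then have "m k j = cnj (m j k)" by blast
  then show "add_rank1 m s v k j = cnj (add_rank1 m s v j k)"
    by (simp only: add_rank1_def) (simp add: mult_ac)
qed

lemma ip_mat_vec_swap:
  assumes "hermitian I m"
  shows "ip I (mat_vec I m a) b = ip I a (mat_vec I m b)"
proof -
  have "ip I (mat_vec I m a) b = (\<Sum>k\<in>I. \<Sum>j\<in>I. m k j * a j * cnj (b k))"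
    by (simp add: ip_def mat_vec_def sum_distrib_right)
  also have "\<dots> = (\<Sum>j\<in>I. \<Sum>k\<in>I. m k j * a j * cnj (b k))"
    by (rule sum.swap)
  also have "\<dots> = (\<Sum>j\<in>I. \<Sum>k\<in>I. cnj (m j k) * a j * cnj (b k))"
    using assms unfolding hermitian_def by (intro sum.cong refl) metis
  also have "\<dots> = ip I a (mat_vec I m b)"
    by (simp add: ip_def mat_vec_def sum_distrib_left mult_ac)
  finally show ?thesis .
qed

lemma ip_mat_vec_pow_swap:
  assumes "hermitian I m"
  shows "ip I ((mat_vec I m ^^ p) a) b = ip I a ((mat_vec I m ^^ p) b)"
proof (induction p arbitrary: b)
  case (Suc p)
  have "ip I ((mat_vec I m ^^ Suc p) a) b = ip I ((mat_vec I m ^^ p) a) (mat_vec I m b)"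
    by (simp add: ip_mat_vec_swap[OF assms])
  also have "\<dots> = ip I a ((mat_vec I m ^^ Suc p) b)"
    by (simp only: Suc funpow_swap1 funpow.simps comp_apply)
  finally show ?case .
qed simp

lemma ip_mat_vec_pow_pow:
  assumes "hermitian I m"
  shows "ip I ((mat_vec I m ^^ p) a) ((mat_vec I m ^^ q) b) = ip I ((mat_vec I m ^^ (p + q)) a) b"
  by (metis add.commute assms comp_apply funpow_add ip_mat_vec_pow_swap)

lemma psd_hermitian: "psd I m \<Longrightarrow> hermitian I m"
  by (simp add: psd_def)

lemma ip_mat_vec_pow_real:
  assumes "hermitian I m"
  shows "ip I ((mat_vec I m ^^ p) v) v = of_real (moment I m p v)"
proof -
  have "cnj (ip I ((mat_vec I m ^^ p) v) v) = ip I ((mat_vec I m ^^ p) v) v"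
    using ip_mat_vec_pow_swap[OF assms] by (metis cnj_ip)
  then show ?thesis
    unfolding moment_def by (metis Reals_cnj_iff complex_is_Real_iff of_real_Re)
qed

section \<open>Moments of positive semidefinite matrices\<close>

lemma moment_0: "moment I m 0 v = sqnorm I v"
  by (simp add: moment_def ip_self)

lemma moment_nonneg:
  assumes "psd I m"
  shows "0 \<le> moment I m p v"
proof -
  note sym = ip_mat_vec_pow_pow[OF psd_hermitian[OF assms]]
  define u where "u = (mat_vec I m ^^ (p div 2)) v"
  show ?thesis
  proof (cases "even p")
    case True
    then have "moment I m p v = Re (ip I u u)"
      unfolding moment_def u_def sym by (simp flip: mult_2)
    then show ?thesis by (simp add: ip_self sqnorm_nonneg)
  next
    case False
    then have "p = Suc (p div 2) + p div 2" by presburger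
    then have "moment I m p v = Re (ip I ((mat_vec I m ^^ (Suc (p div 2))) v) u)"
      unfolding moment_def u_def sym by simp
    then show ?thesis using assms by (simp add: psd_def u_def)
  qed
qed

lemma moment_scale: "moment I m p (\<lambda>k. z * v k) = (cmod z)\<^sup>2 * moment I m p v"
proof -
  have "ip I ((mat_vec I m ^^ p) (\<lambda>k. z * v k)) (\<lambda>k. z * v k) = (z * cnj z) * ip I ((mat_vec I m ^^ p) v) v"
    by (simp add: mat_vec_pow_scale ip_scale_left ip_scale_right)
  then show ?thesis
    by (simp add: moment_def complex_norm_square[symmetric])
qed

text \<open>Cauchy--Schwarz for the positive semidefinite form \<open>\<langle>m\<^sup>p a, b\<rangle>\<close> at \<open>a = v\<close> and \<open>b = m v\<close>, proved from the
discriminant of a real quadratic polynomial.\<close>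

lemma moment_log_convex:
  assumes "psd I m"
  shows "(moment I m (Suc p) v)\<^sup>2 \<le> moment I m p v * moment I m (Suc (Suc p)) v"
proof -
  note h = psd_hermitian[OF assms]
  let ?a = "moment I m p v" and ?b = "moment I m (Suc p) v" and ?c = "moment I m (Suc (Suc p)) v"
  have quad: "0 \<le> ?a + 2 * t * ?b + t\<^sup>2 * ?c" for t :: real
  proof -
    have r1: "ip I ((mat_vec I m ^^ p) (mat_vec I m v)) v = of_real ?b"
      using ip_mat_vec_pow_real[OF h, of "Suc p" v] by (simp add: funpow_swap1)
    have r2: "ip I ((mat_vec I m ^^ p) v) (mat_vec I m v) = of_real ?b"
      using ip_mat_vec_pow_pow[OF h, of p v 1 v] ip_mat_vec_pow_real[OF h, of "Suc p" v] by simp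
    have r3: "ip I ((mat_vec I m ^^ p) (mat_vec I m v)) (mat_vec I m v) = of_real ?c"
      using ip_mat_vec_pow_pow[OF h, of "Suc p" v 1 v] ip_mat_vec_pow_real[OF h, of "Suc (Suc p)" v]
      by (simp add: funpow_swap1)
    have "moment I m p (\<lambda>k. v k + of_real t * mat_vec I m v k) = ?a + 2 * t * ?b + t\<^sup>2 * ?c"
      unfolding moment_def[of I m p "\<lambda>k. v k + of_real t * mat_vec I m v k"]
      by (simp add: mat_vec_pow_add mat_vec_pow_scale ip_add_left ip_add_right ip_scale_left ip_scale_right
          r1 r2 r3 ip_mat_vec_pow_real[OF h, of p v] power2_eq_square algebra_simps)
    then show ?thesis using moment_nonneg[OF assms] by metis
  qed
  have c0: "0 \<le> ?c" and a0: "0 \<le> ?a" using moment_nonneg[OF assms] by auto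
  show ?thesis
  proof (cases "?c = 0")
    case True
    \<comment> \<open>The quadratic polynomial is then affine in t, and it could not stay nonnegative with slope \<open>2 * ?b \<noteq> 0\<close>.\<close>
    have "?b = 0"
    proof (rule ccontr)
      assume "?b \<noteq> 0"
      then have "2 * (- (?a + 1) / (2 * ?b)) * ?b = - (?a + 1)" by simp
      then show False using quad[of "- (?a + 1) / (2 * ?b)"] True by (simp only:)
    qed
    then show ?thesis using True by simp
  next
    case False
    then have pos: "0 < ?c" using c0 by simp
    \<comment> \<open>The minimum of the quadratic polynomial is attained at \<open>- ?b / ?c\<close>.\<close>
    then have "?a + 2 * (- ?b / ?c) * ?b + (- ?b / ?c)\<^sup>2 * ?c = ?a - ?b\<^sup>2 / ?c"
      by (simp add: field_simps power2_eq_square)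
    then have "?b\<^sup>2 / ?c \<le> ?a" using quad[of "- ?b / ?c"] by linarith
    then show ?thesis using pos by (simp add: pos_divide_le_eq)
  qed
qed

text \<open>If all terms are positive, log-convexity says that the ratios of consecutive terms increase. If one
term after the first vanishes, log-convexity propagates the zero in both directions.\<close>

lemma log_convex_supermultiplicative:
  fixes a :: "nat \<Rightarrow> real"
  assumes nonneg: "\<And>k. 0 \<le> a k" and lc: "\<And>k. (a (Suc k))\<^sup>2 \<le> a k * a (Suc (Suc k))"
    and "a 0 = 1"
  shows "a i * a j \<le> a (i + j)"
proof (cases "\<exists>k. a (Suc k) = 0")
  case True
  have up: "a (Suc k) = 0 \<Longrightarrow> a (Suc (Suc k)) = 0" for k
    using lc[of "Suc k"] by simp
  have down: "a (Suc (Suc k)) = 0 \<Longrightarrow> a (Suc k) = 0" for k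
    using lc[of k] by simp
  obtain k where k: "a (Suc k) = 0" using True by blast
  have "a (Suc 0) = 0" using k by (induction k) (auto dest: down)
  then have z: "a (Suc l) = 0" for l by (induction l) (auto dest: up)
  show ?thesis using z \<open>a 0 = 1\<close> nonneg by (cases i; cases j) auto
next
  case False
  then have pos: "0 < a k" for k
    using nonneg \<open>a 0 = 1\<close> by (cases k) (auto simp: less_le)
  have ratio: "a (Suc k) / a k \<le> a (Suc (Suc k)) / a (Suc k)" for k
    using lc[of k] pos[of k] pos[of "Suc k"] by (simp add: field_simps power2_eq_square)
  have mono: "a (Suc k) / a k \<le> a (Suc (k + l)) / a (k + l)" for k l
    by (induction l) (auto intro: order_trans[OF _ ratio])
  show ?thesis
  proof (induction i)
    case 0
    then show ?case using \<open>a 0 = 1\<close> by simp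
  next
    case (Suc i)
    have "a (Suc i) * a j = (a (Suc i) / a i) * (a i * a j)"
      using pos[of i] by simp
    also have "\<dots> \<le> (a (Suc (i + j)) / a (i + j)) * a (i + j)"
      by (rule mult_mono[OF mono Suc]) (auto intro!: divide_nonneg_nonneg mult_nonneg_nonneg nonneg)
    also have "\<dots> = a (Suc i + j)" using pos[of "i + j"] by simp
    finally show ?case .
  qed
qed

text \<open>For a unit vector the moments are those of a probability distribution on \<open>[0, \<infinity>)\<close>, namely the spectral
distribution of \<open>m\<close> at \<open>v\<close>; this is Chebyshev's association inequality for two increasing powers.\<close>

lemma moment_supermultiplicative:
  assumes "psd I m" "sqnorm I v = 1"
  shows "moment I m i v * moment I m j v \<le> moment I m (i + j) v"
  by (rule log_convex_supermultiplicative[of "\<lambda>k. moment I m k v"])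
     (use assms in \<open>auto simp: moment_nonneg moment_log_convex moment_0\<close>)

lemma moment_ge_power:
  assumes "psd I m" "sqnorm I v = 1"
  shows "(moment I m 1 v) ^ p \<le> moment I m p v"
proof (induction p)
  case 0
  then show ?case using assms by (simp add: moment_0)
next
  case (Suc p)
  have "moment I m 1 v ^ Suc p \<le> moment I m 1 v * moment I m p v"
    using Suc moment_nonneg[OF assms(1), of 1 v] by (simp add: mult_left_mono)
  also have "\<dots> \<le> moment I m (Suc p) v"
    using moment_supermultiplicative[OF assms, of 1 p] by simp
  finally show ?case .
qed

section \<open>Rank-one updates of the trace of the exponential\<close>

text \<open>Leibniz rule for powers in a noncommutative algebra: the derivative of \<open>m + s v v\<^sup>*\<close> is \<open>v v\<^sup>*\<close>, which replaces
one of the \<open>p\<close> factors in turn and splits the product at that place.\<close>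

lemma has_vector_derivative_mat_vec_pow:
  fixes v :: "'k \<Rightarrow> complex" and m :: "'k \<Rightarrow> 'k \<Rightarrow> complex"
  assumes "finite I"
  defines "N \<equiv> \<lambda>s. mat_vec I (add_rank1 m s v)"
  shows "((\<lambda>s. (N s ^^ p) c k) has_vector_derivative
           (\<Sum>a<p. ip I ((N s ^^ (p - 1 - a)) c) v * (N s ^^ a) v k)) (at s)"
proof (induction p arbitrary: k)
  case 0
  then show ?case by simp
next
  case (Suc p)
  define X' where "X' = (\<lambda>k. \<Sum>a<p. ip I ((N s ^^ (p - 1 - a)) c) v * (N s ^^ a) v k)"
  have "((\<lambda>s. \<Sum>j\<in>I. add_rank1 m s v k j * (N s ^^ p) c j) has_vector_derivative
         (\<Sum>j\<in>I. add_rank1 m s v k j * X' j + v k * cnj (v j) * (N s ^^ p) c j)) (at s)"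
  proof (rule has_vector_derivative_sum)
    fix j assume "j \<in> I"
    have "((\<lambda>s. add_rank1 m s v k j) has_vector_derivative v k * cnj (v j)) (at s)"
      unfolding add_rank1_def by (auto intro!: derivative_eq_intros)
    then show "((\<lambda>s. add_rank1 m s v k j * (N s ^^ p) c j) has_vector_derivative
         add_rank1 m s v k j * X' j + v k * cnj (v j) * (N s ^^ p) c j) (at s)"
      using has_vector_derivative_mult Suc unfolding X'_def by blast
  qed
  also have "(\<lambda>s. \<Sum>j\<in>I. add_rank1 m s v k j * (N s ^^ p) c j) = (\<lambda>s. (N s ^^ Suc p) c k)"
    by (simp add: N_def mat_vec_def)
  also have "(\<Sum>j\<in>I. add_rank1 m s v k j * X' j + v k * cnj (v j) * (N s ^^ p) c j)
           = N s X' k + ip I ((N s ^^ p) c) v * v k"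
    by (simp add: N_def mat_vec_def ip_def sum.distrib sum_distrib_left mult_ac)
  also have "N s X' = (\<lambda>k. \<Sum>a<p. ip I ((N s ^^ (p - 1 - a)) c) v * (N s ^^ Suc a) v k)"
    unfolding X'_def N_def by (simp add: mat_vec_sum mat_vec_scale)
  also have "(\<Sum>a<p. ip I ((N s ^^ (p - 1 - a)) c) v * (N s ^^ Suc a) v k) + ip I ((N s ^^ p) c) v * v k
     = (\<Sum>a<Suc p. ip I ((N s ^^ (Suc p - 1 - a)) c) v * (N s ^^ a) v k)"
    by (simp add: sum.lessThan_Suc_shift del: sum.lessThan_Suc)
  finally show ?case .
qed

lemma has_vector_derivative_ip_mat_vec_pow:
  fixes v :: "'k \<Rightarrow> complex" and m :: "'k \<Rightarrow> 'k \<Rightarrow> complex"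
  assumes "finite I"
  defines "N \<equiv> \<lambda>s. mat_vec I (add_rank1 m s v)"
  shows "((\<lambda>s. ip I ((N s ^^ p) c) b) has_vector_derivative
           (\<Sum>a<p. ip I ((N s ^^ (p - 1 - a)) c) v * ip I ((N s ^^ a) v) b)) (at s)"
proof -
  have "((\<lambda>s. \<Sum>k\<in>I. (N s ^^ p) c k * cnj (b k)) has_vector_derivative
     (\<Sum>k\<in>I. (\<Sum>a<p. ip I ((N s ^^ (p - 1 - a)) c) v * (N s ^^ a) v k) * cnj (b k))) (at s)"
    unfolding N_def
    by (intro has_vector_derivative_sum has_vector_derivative_mult_left
          has_vector_derivative_mat_vec_pow[OF assms(1)])
  also have "(\<Sum>k\<in>I. (\<Sum>a<p. ip I ((N s ^^ (p - 1 - a)) c) v * (N s ^^ a) v k) * cnj (b k))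
    = ip I (\<lambda>k. \<Sum>a<p. ip I ((N s ^^ (p - 1 - a)) c) v * (N s ^^ a) v k) b"
    by (simp add: ip_def)
  also have "\<dots> = (\<Sum>a<p. ip I ((N s ^^ (p - 1 - a)) c) v * ip I ((N s ^^ a) v) b)"
    by (simp add: ip_sum_left ip_scale_left)
  finally show ?thesis by (simp add: ip_def)
qed

lemma has_real_derivative_Re_ip_mat_vec_pow:
  assumes "finite I"
  shows "((\<lambda>s. Re (ip I ((mat_vec I (add_rank1 m s v) ^^ p) c) b)) has_real_derivative
           Re (\<Sum>a<p. ip I ((mat_vec I (add_rank1 m s v) ^^ (p - 1 - a)) c) v *
                       ip I ((mat_vec I (add_rank1 m s v) ^^ a) v) b)) (at s)"
  using has_vector_derivative_ip_mat_vec_pow[OF assms, where m=m and v=v and p=p and c=c and b=b and s=s,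
      THEN bounded_linear.has_vector_derivative[OF bounded_linear_Re]]
  by (simp add: has_real_derivative_iff_has_vector_derivative)

lemma has_real_derivative_moment:
  assumes "finite I" "hermitian I m"
  shows "((\<lambda>s. moment I (add_rank1 m s v) p v) has_real_derivative
     (\<Sum>a<p. moment I (add_rank1 m s v) (p - 1 - a) v * moment I (add_rank1 m s v) a v)) (at s)"
  using has_real_derivative_Re_ip_mat_vec_pow[OF assms(1), where m=m and v=v and p=p and c=v and b=v and s=s]
  unfolding moment_def[of I _ p] by (simp add: ip_mat_vec_pow_real hermitian_add_rank1 assms)

text \<open>Under the trace the \<open>p\<close> terms of the Leibniz rule are cyclic rotations of each other, so they all equal
the moment of order \<open>p - 1\<close>.\<close>

lemma has_real_derivative_trace_power:
  assumes "finite I" "hermitian I m"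
  shows "((\<lambda>s. \<Sum>k\<in>I. moment I (add_rank1 m s v) p (unit_vec k)) has_real_derivative
     real p * moment I (add_rank1 m s v) (p - 1) v) (at s)"
proof -
  let ?N = "mat_vec I (add_rank1 m s v)"
  have h: "hermitian I (add_rank1 m s v)" using assms by (simp add: hermitian_add_rank1)
  have "((\<lambda>s. \<Sum>k\<in>I. moment I (add_rank1 m s v) p (unit_vec k)) has_real_derivative
     (\<Sum>k\<in>I. Re (\<Sum>a<p. ip I ((?N ^^ (p - 1 - a)) (unit_vec k)) v * ip I ((?N ^^ a) v) (unit_vec k)))) (at s)"
    unfolding moment_def by (intro DERIV_sum has_real_derivative_Re_ip_mat_vec_pow assms)
  also have "(\<Sum>k\<in>I. Re (\<Sum>a<p. ip I ((?N ^^ (p - 1 - a)) (unit_vec k)) v * ip I ((?N ^^ a) v) (unit_vec k)))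
    = Re (\<Sum>k\<in>I. (\<Sum>a<p. cnj ((?N ^^ (p - 1 - a)) v k) * (?N ^^ a) v k))"
    unfolding Re_sum[symmetric]
    by (intro arg_cong[where f=Re] sum.cong refl)
       (simp only: ip_mat_vec_pow_swap[OF h, of _ "unit_vec _"] ip_unit_vec_left ip_unit_vec_right assms)
  also have "(\<Sum>k\<in>I. (\<Sum>a<p. cnj ((?N ^^ (p - 1 - a)) v k) * (?N ^^ a) v k))
    = (\<Sum>a<p. ip I ((?N ^^ a) v) ((?N ^^ (p - 1 - a)) v))"
    unfolding ip_def by (subst sum.swap) (simp add: mult.commute)
  also have "\<dots> = (\<Sum>a<p. of_real (moment I (add_rank1 m s v) (p - 1) v))"
    by (intro sum.cong refl) (simp add: ip_mat_vec_pow_pow[OF h] ip_mat_vec_pow_real[OF h])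
  finally show ?thesis by simp
qed

lemma psd_add_rank1_between:
  assumes "psd I m" "psd I (add_rank1 m s v)" "u \<in> closed_segment 0 s"
  shows "psd I (add_rank1 m u v)"
proof -
  obtain q where q: "0 \<le> q" "q \<le> 1" "u = q * s"
    using assms(3) by (auto simp: closed_segment_def)
  have *: "Re (ip I (mat_vec I (add_rank1 m x v) c) c) = Re (ip I (mat_vec I m c) c) + x * (cmod (ip I c v))\<^sup>2" for x c
  proof -
    have "ip I c v * ip I v c = of_real ((cmod (ip I c v))\<^sup>2)"
      by (metis cnj_ip complex_norm_square)
    then show ?thesis
      by (simp add: mat_vec_add_rank1 ip_add_left ip_scale_left mult.assoc)
  qed
  have "0 \<le> Re (ip I (mat_vec I m c) c) + u * (cmod (ip I c v))\<^sup>2" for c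
  proof -
    have "0 \<le> (1 - q) * Re (ip I (mat_vec I m c) c) + q * (Re (ip I (mat_vec I m c) c) + s * (cmod (ip I c v))\<^sup>2)"
      using assms(1,2) q(1,2) unfolding psd_def *
      by (intro add_nonneg_nonneg[OF mult_nonneg_nonneg mult_nonneg_nonneg]) auto
    then show ?thesis by (simp add: q(3) algebra_simps)
  qed
  then show ?thesis
    using assms(1) unfolding psd_def * by (simp add: hermitian_add_rank1)
qed

text \<open>Truncation of \<open>exp_form\<close> after \<open>n\<close> terms: along the path \<open>m + s v v\<^sup>*\<close> it is a polynomial in \<open>s\<close>, whose
derivative is a finite sum.\<close>

definition exp_form_trunc ::
    "'k set \<Rightarrow> ('k \<Rightarrow> 'k \<Rightarrow> complex) \<Rightarrow> nat \<Rightarrow> ('k \<Rightarrow> complex) \<Rightarrow> real" where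
  "exp_form_trunc I m n v = (\<Sum>p<n. moment I m p v / fact p)"

text \<open>Let \<open>G u\<close> be the truncated trace and \<open>H u\<close> the truncated form at the matrix \<open>m + u v v\<^sup>*\<close>. Then \<open>G' = H\<close>, where
differentiation lowers the order of truncation by one, and \<open>H' \<le> H\<close> by supermultiplicativity of
moments. Hence \<open>exp (- u) * H u\<close> decreases, and comparing \<open>H u\<close> with \<open>exp u * H 0\<close> and integrating from \<open>0\<close>
to \<open>s\<close> gives the same upper bound for positive and for negative \<open>s\<close>.\<close>

lemma exp_form_trunc_rank1_update:
  assumes "finite I" "psd I m" "psd I (add_rank1 m s v)" "sqnorm I v = 1"
  shows "(\<Sum>k\<in>I. exp_form_trunc I (add_rank1 m s v) (Suc n) (unit_vec k))
     \<le> (\<Sum>k\<in>I. exp_form_trunc I m (Suc n) (unit_vec k)) + (exp s - 1) * exp_form_trunc I m n v"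
proof -
  define M where "M = (\<lambda>u. add_rank1 m u v)"
  define H where "H = (\<lambda>u. exp_form_trunc I (M u) n v)"
  define G where "G = (\<lambda>u. \<Sum>k\<in>I. exp_form_trunc I (M u) (Suc n) (unit_vec k))"
  define H' where "H' = (\<lambda>u. \<Sum>p<n. (\<Sum>a<p. moment I (M u) (p - 1 - a) v * moment I (M u) a v) / fact p)"
  note hm = psd_hermitian[OF assms(2)]
  have M0: "M 0 = m" by (simp add: M_def add_rank1_def)
  have psdM: "psd I (M u)" if "u \<in> closed_segment 0 s" for u
    unfolding M_def using psd_add_rank1_between[OF assms(2,3) that] .
  have dH: "(H has_real_derivative H' u) (at u)" for u
    unfolding H_def H'_def exp_form_trunc_def M_def
    by (intro DERIV_sum DERIV_cdivide has_real_derivative_moment assms hm)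
  have dG: "(G has_real_derivative H u) (at u)" for u
  proof -
    have "((\<lambda>u. \<Sum>p<Suc n. (\<Sum>k\<in>I. moment I (M u) p (unit_vec k)) / fact p) has_real_derivative
      (\<Sum>p<Suc n. (real p * moment I (M u) (p - 1) v) / fact p)) (at u)"
      unfolding M_def by (intro DERIV_sum DERIV_cdivide has_real_derivative_trace_power assms hm)
    also have "(\<Sum>p<Suc n. (real p * moment I (M u) (p - 1) v) / fact p) = H u"
      unfolding H_def exp_form_trunc_def
      by (simp add: sum.lessThan_Suc_shift del: sum.lessThan_Suc)
    also have "(\<lambda>u. \<Sum>p<Suc n. (\<Sum>k\<in>I. moment I (M u) p (unit_vec k)) / fact p) = G"
      unfolding G_def exp_form_trunc_def by (rule ext) (subst sum.swap, simp only: sum_divide_distrib)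
    finally show ?thesis .
  qed
  have H'_le: "H' u \<le> H u" if "u \<in> closed_segment 0 s" for u
  proof (cases n)
    case (Suc n')
    have "H' u \<le> (\<Sum>p<n. (\<Sum>a<p. moment I (M u) (p - 1) v) / fact p)"
      unfolding H'_def
    proof (intro sum_mono divide_right_mono)
      fix p a :: nat assume "a \<in> {..<p}"
      then show "moment I (M u) (p - 1 - a) v * moment I (M u) a v \<le> moment I (M u) (p - 1) v"
        using moment_supermultiplicative[OF psdM[OF that] assms(4), of "p - 1 - a" a] by simp
    qed simp
    also have "\<dots> = (\<Sum>p<n'. moment I (M u) p v / fact p)"
      unfolding Suc by (simp add: sum.lessThan_Suc_shift del: sum.lessThan_Suc)
    also have "\<dots> \<le> H u"
      unfolding H_def exp_form_trunc_def Suc using moment_nonneg[OF psdM[OF that]] by simp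
    finally show ?thesis .
  qed (simp add: H_def H'_def exp_form_trunc_def)
  define F where "F = (\<lambda>u. exp (- u) * H u)"
  have dF: "(F has_real_derivative exp (- u) * (H' u - H u)) (at u)" for u
    unfolding F_def by (auto intro!: derivative_eq_intros dH simp: algebra_simps)
  have dF_le: "exp (- u) * (H' u - H u) \<le> 0" if "u \<in> closed_segment 0 s" for u
    using H'_le[OF that] by (simp add: mult_le_0_iff)
  define E where "E = (\<lambda>u. G u - exp u * H 0)"
  have dE: "(E has_real_derivative exp u * (F u - F 0)) (at u)" for u
    unfolding E_def F_def
    by (auto intro!: derivative_eq_intros dG simp: algebra_simps exp_minus)
  \<comment> \<open>For negative \<open>s\<close> both the comparison of \<open>H\<close> and the direction of integration are reversed.\<close>
  have "E s \<le> E 0"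
  proof (cases "0 \<le> s")
    case True
    show ?thesis
    proof (rule DERIV_nonpos_imp_nonincreasing[OF True])
      fix u assume u: "0 \<le> u" "u \<le> s"
      have "F u \<le> F 0"
        by (rule DERIV_nonpos_imp_nonincreasing[OF u(1)])
           (use u True dF dF_le in \<open>fastforce simp: closed_segment_eq_real_ivl\<close>)
      then show "\<exists>y. (E has_real_derivative y) (at u) \<and> y \<le> 0"
        using dE by (intro exI[of _ "exp u * (F u - F 0)"]) (simp add: mult_le_0_iff)
    qed
  next
    case False
    then have "s \<le> 0" by simp
    then show ?thesis
    proof (rule DERIV_nonneg_imp_nondecreasing)
      fix u assume u: "s \<le> u" "u \<le> 0"
      have "F 0 \<le> F u"
        by (rule DERIV_nonpos_imp_nonincreasing[OF u(2)])
           (use u False dF dF_le in \<open>fastforce simp: closed_segment_eq_real_ivl\<close>)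
      then show "\<exists>y. (E has_real_derivative y) (at u) \<and> 0 \<le> y"
        using dE by (intro exI[of _ "exp u * (F u - F 0)"]) simp
    qed
  qed
  then show ?thesis
    unfolding E_def G_def H_def M0 by (simp add: M_def algebra_simps)
qed

section \<open>The exponential form and its square root\<close>

lemma sum_cmod_mat_vec_pow_le:
  assumes "finite I"
  shows "(\<Sum>k\<in>I. cmod ((mat_vec I m ^^ p) c k)) \<le> (\<Sum>k\<in>I. \<Sum>j\<in>I. cmod (m k j)) ^ p * (\<Sum>k\<in>I. cmod (c k))"
    (is "?n p \<le> ?r ^ p * _")
proof (induction p)
  case (Suc p)
  have "?n (Suc p) \<le> (\<Sum>k\<in>I. \<Sum>j\<in>I. cmod (m k j) * cmod ((mat_vec I m ^^ p) c j))"
    unfolding funpow.simps comp_apply mat_vec_def[of I m "(mat_vec I m ^^ p) c"]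
    by (intro sum_mono order_trans[OF norm_sum]) (simp add: norm_mult)
  also have "\<dots> = (\<Sum>j\<in>I. (\<Sum>k\<in>I. cmod (m k j)) * cmod ((mat_vec I m ^^ p) c j))"
    by (subst sum.swap) (simp add: sum_distrib_right)
  also have "\<dots> \<le> (\<Sum>j\<in>I. ?r * cmod ((mat_vec I m ^^ p) c j))"
  proof (intro sum_mono mult_right_mono)
    fix j assume "j \<in> I"
    then show "cmod (m k j) \<le> (\<Sum>j\<in>I. cmod (m k j))" for k
      using assms by (intro member_le_sum) auto
  qed simp
  also have "\<dots> = ?r * ?n p" by (simp add: sum_distrib_left)
  also have "\<dots> \<le> ?r * (?r ^ p * (\<Sum>k\<in>I. cmod (c k)))"
    by (intro mult_left_mono Suc sum_nonneg) auto
  finally show ?case by (simp add: mult_ac)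
qed simp

lemma summable_mat_vec_pow:
  assumes "finite I" "k \<in> I"
  shows "summable (\<lambda>p. cmod (of_real (q ^ p / fact p) * (mat_vec I m ^^ p) c k))"
proof -
  define r where "r = (\<Sum>k\<in>I. \<Sum>j\<in>I. cmod (m k j))"
  define b where "b = (\<Sum>k\<in>I. cmod (c k))"
  have "summable (\<lambda>p. b * (inverse (fact p) * (\<bar>q\<bar> * r) ^ p))"
    by (intro summable_mult summable_exp)
  then show ?thesis
  proof (rule summable_comparison_test')
    fix p
    have "cmod ((mat_vec I m ^^ p) c k) \<le> (\<Sum>k\<in>I. cmod ((mat_vec I m ^^ p) c k))"
      using assms by (intro member_le_sum) auto
    also have "\<dots> \<le> r ^ p * b" unfolding r_def b_def by (rule sum_cmod_mat_vec_pow_le[OF assms(1)])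
    finally have "\<bar>q\<bar> ^ p / fact p * cmod ((mat_vec I m ^^ p) c k) \<le> \<bar>q\<bar> ^ p / fact p * (r ^ p * b)"
      by (intro mult_left_mono) auto
    then show "norm (cmod (of_real (q ^ p / fact p) * (mat_vec I m ^^ p) c k)) \<le> b * (inverse (fact p) * (\<bar>q\<bar> * r) ^ p)"
      by (simp add: norm_mult norm_divide norm_power field_simps)
  qed
qed

lemma Re_divide_fact: "Re (z / fact p) = Re z / fact p"
  using Re_divide_of_real[of z "fact p"] by simp

lemma summable_moment:
  assumes "finite I"
  shows "summable (\<lambda>p. moment I m p v / fact p)"
proof -
  have "summable (\<lambda>p. of_real (1 ^ p / fact p) * (mat_vec I m ^^ p) v k)" if "k \<in> I" for k
    using summable_norm_cancel[OF summable_mat_vec_pow[OF assms that]] .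
  then have "summable (\<lambda>p. \<Sum>k\<in>I. of_real (1 ^ p / fact p) * (mat_vec I m ^^ p) v k * cnj (v k))"
    by (intro summable_sum summable_mult2)
  then have "summable (\<lambda>p. Re (\<Sum>k\<in>I. of_real (1 ^ p / fact p) * (mat_vec I m ^^ p) v k * cnj (v k)))"
    by (rule summable_Re)
  also have "(\<lambda>p. Re (\<Sum>k\<in>I. of_real (1 ^ p / fact p) * (mat_vec I m ^^ p) v k * cnj (v k)))
    = (\<lambda>p. moment I m p v / fact p)"
  proof
    fix p
    have "(\<Sum>k\<in>I. of_real (1 ^ p / fact p) * (mat_vec I m ^^ p) v k * cnj (v k))
        = ip I ((mat_vec I m ^^ p) v) v / fact p"
      by (simp add: ip_def sum_divide_distrib)
    then show "Re (\<Sum>k\<in>I. of_real (1 ^ p / fact p) * (mat_vec I m ^^ p) v k * cnj (v k)) = moment I m p v / fact p"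
      by (simp only: moment_def Re_divide_fact)
  qed
  finally show ?thesis .
qed

lemma exp_form_trunc_tendsto:
  assumes "finite I"
  shows "(\<lambda>n. exp_form_trunc I m n v) \<longlonglongrightarrow> exp_form I m v"
  unfolding exp_form_trunc_def exp_form_def using summable_LIMSEQ[OF summable_moment[OF assms]] .

lemma trace_exp_rank1_update_unit:
  assumes "finite I" "psd I m" "psd I (add_rank1 m s v)" "sqnorm I v = 1"
  shows "trace_exp I (add_rank1 m s v) \<le> trace_exp I m + (exp s - 1) * exp_form I m v"
proof (rule LIMSEQ_le)
  show "\<exists>N. \<forall>n\<ge>N. (\<Sum>k\<in>I. exp_form_trunc I (add_rank1 m s v) (Suc n) (unit_vec k))
     \<le> (\<Sum>k\<in>I. exp_form_trunc I m (Suc n) (unit_vec k)) + (exp s - 1) * exp_form_trunc I m n v"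
    using exp_form_trunc_rank1_update[OF assms] by blast
  note lim = exp_form_trunc_tendsto[OF assms(1)]
  show "(\<lambda>n. \<Sum>k\<in>I. exp_form_trunc I (add_rank1 m s v) (Suc n) (unit_vec k))
     \<longlonglongrightarrow> trace_exp I (add_rank1 m s v)"
    unfolding trace_exp_def by (intro tendsto_sum LIMSEQ_Suc lim)
  show "(\<lambda>n. (\<Sum>k\<in>I. exp_form_trunc I m (Suc n) (unit_vec k)) + (exp s - 1) * exp_form_trunc I m n v)
     \<longlonglongrightarrow> trace_exp I m + (exp s - 1) * exp_form I m v"
    unfolding trace_exp_def by (intro tendsto_intros LIMSEQ_Suc lim)
qed

lemma exp_form_nonneg: "finite I \<Longrightarrow> psd I m \<Longrightarrow> 0 \<le> exp_form I m v"
  unfolding exp_form_def by (intro suminf_nonneg summable_moment) (auto simp: moment_nonneg)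

lemma exp_form_scale: "finite I \<Longrightarrow> exp_form I m (\<lambda>k. z * v k) = (cmod z)\<^sup>2 * exp_form I m v"
  unfolding exp_form_def moment_scale times_divide_eq_right[symmetric]
  by (rule suminf_mult[OF summable_moment])

text \<open>The vectors are \<open>w k = exp (m / 2) e\<^sub>k\<close>. By the Cauchy product \<open>\<langle>exp m v, v\<rangle> = \<parallel>exp (m / 2) v\<parallel>\<^sup>2\<close>, and
\<open>exp (m / 2)\<close> is Hermitian, so the entry of \<open>exp (m / 2) v\<close> at \<open>k\<close> is \<open>\<langle>v, w k\<rangle>\<close>. This makes the trace of
\<open>exp m\<close> times any form \<open>\<Sum>i. y\<^sub>i y\<^sub>i\<^sup>*\<close> a sum of values of that form, which is how bounds on the form turn
into bounds on the trace.\<close>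

lemma exp_form_square_root:
  assumes "finite I" "hermitian I m"
  obtains w where "\<And>v. exp_form I m v = (\<Sum>k\<in>I. (cmod (ip I v (w k)))\<^sup>2)"
proof -
  define x where "x = (\<lambda>c k p. of_real ((1/2) ^ p / fact p) * (mat_vec I m ^^ p) c k)"
  define X where "X = (\<lambda>c k. \<Sum>p. x c k p)"
  define w where "w = (\<lambda>k. X (unit_vec k))"
  have abs: "summable (\<lambda>p. norm (x c k p))" if "k \<in> I" for c k
    unfolding x_def by (rule summable_mat_vec_pow[OF assms(1) that])
  have x_sums: "x c k sums X c k" if "k \<in> I" for c k
    unfolding X_def using abs[OF that] by (rule summable_sums[OF summable_norm_cancel])
  have ip_X: "(\<lambda>n. \<Sum>p\<le>n. ip I (\<lambda>k. x a k p) (\<lambda>k. x b k (n - p))) sums ip I (X a) (X b)" for a b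
  proof -
    have "(\<lambda>n. \<Sum>p\<le>n. x a k p * cnj (x b k (n - p))) sums (X a k * cnj (X b k))" if "k \<in> I" for k
    proof -
      have "(\<lambda>p. cnj (x b k p)) sums cnj (X b k)"
        using x_sums[OF that] by (simp add: sums_cnj)
      then show ?thesis
        using Cauchy_product_sums[of "x a k" "\<lambda>p. cnj (x b k p)"] abs[OF that]
        by (simp add: X_def sums_iff)
    qed
    then have "(\<lambda>n. \<Sum>k\<in>I. \<Sum>p\<le>n. x a k p * cnj (x b k (n - p))) sums ip I (X a) (X b)"
      unfolding ip_def by (rule sums_sum)
    then show ?thesis unfolding ip_def by (subst sum.swap)
  qed
  \<comment> \<open>The powers of \<open>1/2\<close> and the factorials combine to the binomial expansion of \<open>(1/2 + 1/2) ^ n\<close>.\<close>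
  have coeff: "(\<Sum>p\<le>n. ip I (\<lambda>k. x a k p) (\<lambda>k. x b k (n - p))) = ip I ((mat_vec I m ^^ n) a) b / fact n" for a b n
  proof -
    have "(\<Sum>p\<le>n. ip I (\<lambda>k. x a k p) (\<lambda>k. x b k (n - p)))
        = (\<Sum>p\<le>n. of_real ((1/2) ^ p / fact p * ((1/2) ^ (n - p) / fact (n - p))) * ip I ((mat_vec I m ^^ n) a) b)"
      unfolding x_def by (intro sum.cong refl) (simp only: ip_scale_left ip_scale_right, simp add: ip_mat_vec_pow_pow[OF assms(2)])
    also have "\<dots> = of_real (\<Sum>p\<le>n. (1/2) ^ p / fact p * ((1/2) ^ (n - p) / fact (n - p))) * ip I ((mat_vec I m ^^ n) a) b"
      by (simp add: sum_distrib_right)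
    also have "(\<Sum>p\<le>n. (1/2) ^ p / fact p * ((1/2) ^ (n - p) / fact (n - p))) = (1 / fact n :: real)"
    proof -
      have "(\<Sum>p\<le>n. (1/2::real) ^ p / fact p * ((1/2) ^ (n - p) / fact (n - p)))
          = (\<Sum>p\<le>n. of_nat (n choose p) * (1/2) ^ p * (1/2) ^ (n - p)) / fact n"
        unfolding sum_divide_distrib by (intro sum.cong refl) (simp add: binomial_fact field_simps)
      also have "\<dots> = (1/2 + 1/2) ^ n / fact n" by (simp only: binomial_ring)
      finally show ?thesis by simp
    qed
    finally show ?thesis by simp
  qed
  have polar: "(\<lambda>n. ip I ((mat_vec I m ^^ n) a) b / fact n) sums ip I (X a) (X b)" for a b
    using ip_X[of a b] unfolding coeff .
  have "exp_form I m v = Re (ip I (X v) (X v))" for v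
  proof -
    have "(\<lambda>n. Re (ip I ((mat_vec I m ^^ n) v) v / fact n)) sums Re (ip I (X v) (X v))"
      by (rule sums_Re[OF polar])
    moreover have "Re (ip I ((mat_vec I m ^^ n) v) v / fact n) = moment I m n v / fact n" for n
      by (simp add: moment_def Re_divide_fact)
    ultimately show ?thesis unfolding exp_form_def by (simp add: sums_iff)
  qed
  moreover have "X v k = ip I v (w k)" if k: "k \<in> I" for v k
  proof -
    have "ip I v (w k) = (\<Sum>j\<in>I. v j * cnj (X (unit_vec k) j))" by (simp add: ip_def w_def)
    have l1: "(\<lambda>n. ip I ((\<lambda>j. x v j n)) (unit_vec k)) sums X v k"
      using x_sums[OF k] by (simp add: ip_unit_vec_right assms k)
    have "(\<lambda>n. cnj (x (unit_vec k) j n)) sums cnj (w k j)" if "j \<in> I" for j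
      using x_sums[OF that] by (simp add: sums_cnj w_def)
    then have "(\<lambda>n. \<Sum>j\<in>I. v j * cnj (x (unit_vec k) j n)) sums ip I v (w k)"
      unfolding ip_def by (intro sums_sum sums_mult)
    moreover have "(\<Sum>j\<in>I. v j * cnj (x (unit_vec k) j n)) = ip I ((\<lambda>j. x v j n)) (unit_vec k)" for n
    proof -
      have "(\<Sum>j\<in>I. v j * cnj (x (unit_vec k) j n)) = ip I v (\<lambda>j. x (unit_vec k) j n)"
        by (simp add: ip_def)
      also have "\<dots> = ip I (\<lambda>j. x v j n) (unit_vec k)"
        unfolding x_def
        by (simp only: ip_scale_left ip_scale_right ip_mat_vec_pow_swap[OF assms(2)]) simp
      finally show ?thesis .
    qed
    ultimately show ?thesis using l1 by (simp add: sums_iff)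
  qed
  ultimately have "exp_form I m v = (\<Sum>k\<in>I. (cmod (ip I v (w k)))\<^sup>2)" for v
    by (simp add: ip_self sqnorm_def)
  then show ?thesis by (rule that)
qed

section \<open>Matrix Chernoff bound for sums of rank-one matrices\<close>

lemma moment_cong:
  assumes "\<And>k j. k \<in> I \<Longrightarrow> j \<in> I \<Longrightarrow> m k j = m' k j"
  shows "moment I m p v = moment I m' p v"
proof -
  have "(mat_vec I m ^^ p) v k = (mat_vec I m' ^^ p) v k" if "k \<in> I" for k
    using that assms by (induction p arbitrary: k) (simp_all add: mat_vec_def)
  then show ?thesis unfolding moment_def by (intro arg_cong[where f=Re] ip_cong) auto
qed

lemma exp_chord:
  fixes \<sigma> s r :: real
  assumes "0 \<le> s" "s \<le> r" "0 < r"
  shows "exp (\<sigma> * s) - 1 \<le> (exp (\<sigma> * r) - 1) / r * s"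
proof -
  have "exp ((1 - s / r) *\<^sub>R 0 + (s / r) *\<^sub>R (\<sigma> * r)) \<le> (1 - s / r) * exp 0 + (s / r) * exp (\<sigma> * r)"
    by (rule convex_onD[OF exp_convex]) (use assms in auto)
  moreover have "(1 - s / r) *\<^sub>R 0 + (s / r) *\<^sub>R (\<sigma> * r) = \<sigma> * s"
    using assms by simp
  moreover have "(1 - s / r) * exp 0 + (s / r) * exp (\<sigma> * r) = 1 + (exp (\<sigma> * r) - 1) / r * s"
    by (simp add: diff_divide_distrib left_diff_distrib)
  ultimately show ?thesis by simp
qed

text \<open>The update by a unit vector, rescaled to a vector of squared norm at most \<open>r\<close>. Convexity of the
exponential linearises the dependence on the squared norm, so that the bound can be averaged over \<open>y\<close>.\<close>

lemma trace_exp_rank1_update: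
  assumes "finite I" "psd I m" "psd I (add_rank1 m \<sigma> y)" "sqnorm I y \<le> r" "0 < r"
  shows "trace_exp I (add_rank1 m \<sigma> y) \<le> trace_exp I m + (exp (\<sigma> * r) - 1) / r * exp_form I m y"
proof (cases "sqnorm I y = 0")
  case True
  then have y0: "y k = 0" if "k \<in> I" for k using that assms(1) by (simp add: sqnorm_eq_0)
  have "moment I (add_rank1 m \<sigma> y) p v = moment I m p v" for p v
    by (rule moment_cong) (simp add: add_rank1_def y0)
  moreover have "moment I m p y = 0" for p
    by (simp add: moment_def ip_def y0)
  ultimately show ?thesis by (simp add: trace_exp_def exp_form_def)
next
  case False
  define s where "s = sqnorm I y"
  have s: "0 < s" "s \<le> r" using False sqnorm_nonneg[of I y] assms(4) by (auto simp: s_def)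
  define v where "v = (\<lambda>k. of_real (1 / sqrt s) * y k)"
  have sqv: "sqnorm I v = 1"
    unfolding v_def sqnorm_scale using s by (simp add: s_def norm_divide power_divide)
  have y: "y = (\<lambda>k. of_real (sqrt s) * v k)" using s by (simp add: v_def fun_eq_iff)
  have ss: "complex_of_real (sqrt s) * complex_of_real (sqrt s) = of_real s"
    using s by (simp flip: of_real_mult)
  have eq: "add_rank1 m \<sigma> y = add_rank1 m (\<sigma> * s) v"
    unfolding add_rank1_def y by (intro ext) (simp flip: ss add: mult_ac)
  have "trace_exp I (add_rank1 m \<sigma> y) \<le> trace_exp I m + (exp (\<sigma> * s) - 1) * exp_form I m v"
    using trace_exp_rank1_update_unit[OF assms(1,2) _ sqv, of "\<sigma> * s"] assms(3) unfolding eq by simp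
  also have "\<dots> \<le> trace_exp I m + ((exp (\<sigma> * r) - 1) / r * s) * exp_form I m v"
    using exp_chord[of s r \<sigma>] s assms(5) exp_form_nonneg[OF assms(1,2)]
    by (intro add_left_mono mult_right_mono) auto
  also have "s * exp_form I m v = exp_form I m y"
    unfolding y exp_form_scale[OF assms(1)] using s by simp
  then have "(exp (\<sigma> * r) - 1) / r * s * exp_form I m v = (exp (\<sigma> * r) - 1) / r * exp_form I m y"
    by (metis mult.assoc)
  finally show ?thesis .
qed

text \<open>The number \<open>\<mu>\<close> bounds the expectation of the random matrix \<open>y y\<^sup>*\<close> in the direction of the sign: from above for
\<open>\<sigma> = 1\<close> and from below for \<open>\<sigma> = - 1\<close>. The factor \<open>(exp (\<sigma> * r) - 1) / r\<close> has the sign of \<open>\<sigma>\<close>, so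
this is the direction that is needed.\<close>

lemma trace_exp_average_update:
  assumes "finite I" "psd I m" "finite S"
    and prob: "\<And>i. i \<in> S \<Longrightarrow> 0 \<le> \<rho> i" "(\<Sum>i\<in>S. \<rho> i) = 1"
    and y: "\<And>i. i \<in> S \<Longrightarrow> psd I (add_rank1 m \<sigma> (y i))" "\<And>i. i \<in> S \<Longrightarrow> sqnorm I (y i) \<le> r" "0 < r"
    and mean: "\<And>w. \<sigma> * (\<Sum>i\<in>S. \<rho> i * (cmod (ip I w (y i)))\<^sup>2) \<le> \<sigma> * (\<mu> * sqnorm I w)"
    and "\<sigma> = 1 \<or> \<sigma> = - 1"
  shows "(\<Sum>i\<in>S. \<rho> i * trace_exp I (add_rank1 m \<sigma> (y i)))
    \<le> exp ((exp (\<sigma> * r) - 1) / r * \<mu>) * trace_exp I m"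
proof -
  define \<kappa> where "\<kappa> = (exp (\<sigma> * r) - 1) / r"
  obtain w where w: "\<And>v. exp_form I m v = (\<Sum>k\<in>I. (cmod (ip I v (w k)))\<^sup>2)"
    using exp_form_square_root[OF assms(1) psd_hermitian[OF assms(2)]] by blast
  have tr: "trace_exp I m = (\<Sum>k\<in>I. sqnorm I (w k))"
  proof -
    have "trace_exp I m = (\<Sum>j\<in>I. \<Sum>k\<in>I. (cmod (w k j))\<^sup>2)"
      unfolding trace_exp_def w by (intro sum.cong refl) (simp add: ip_unit_vec_left assms(1))
    then show ?thesis unfolding sqnorm_def by (subst (asm) sum.swap)
  qed
  have sgn: "\<kappa> * a \<le> \<kappa> * b" if "\<sigma> * a \<le> \<sigma> * b" for a b
    using assms(10)
  proof
    assume "\<sigma> = 1"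
    then show ?thesis using that y(3) unfolding \<kappa>_def by (intro mult_left_mono) auto
  next
    assume "\<sigma> = - 1"
    then show ?thesis using that y(3) unfolding \<kappa>_def
      by (intro mult_left_mono_neg divide_nonpos_pos) auto
  qed
  have "(\<Sum>i\<in>S. \<rho> i * trace_exp I (add_rank1 m \<sigma> (y i)))
    \<le> (\<Sum>i\<in>S. \<rho> i * (trace_exp I m + \<kappa> * exp_form I m (y i)))"
    unfolding \<kappa>_def using assms by (intro sum_mono mult_left_mono trace_exp_rank1_update) auto
  also have "\<dots> = (\<Sum>i\<in>S. \<rho> i) * trace_exp I m + \<kappa> * (\<Sum>i\<in>S. \<rho> i * exp_form I m (y i))"
    by (simp add: distrib_left sum.distrib sum_distrib_left sum_distrib_right mult_ac)
  also have "(\<Sum>i\<in>S. \<rho> i * exp_form I m (y i)) = (\<Sum>k\<in>I. \<Sum>i\<in>S. \<rho> i * (cmod (ip I (w k) (y i)))\<^sup>2)"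
  proof -
    have "cmod (ip I (w k) (y i)) = cmod (ip I (y i) (w k))" for k i
      by (metis cnj_ip complex_mod_cnj)
    then show ?thesis unfolding w sum_distrib_left by (subst sum.swap) simp
  qed
  also have "\<kappa> * \<dots> = (\<Sum>k\<in>I. \<kappa> * (\<Sum>i\<in>S. \<rho> i * (cmod (ip I (w k) (y i)))\<^sup>2))"
    by (rule sum_distrib_left)
  also have "\<dots> \<le> (\<Sum>k\<in>I. \<kappa> * (\<mu> * sqnorm I (w k)))"
    by (intro sum_mono sgn mean)
  also have "\<dots> = \<kappa> * \<mu> * trace_exp I m"
    unfolding tr by (simp add: sum_distrib_left mult.assoc)
  finally have "(\<Sum>i\<in>S. \<rho> i * trace_exp I (add_rank1 m \<sigma> (y i))) \<le> (1 + \<kappa> * \<mu>) * trace_exp I m"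
    by (simp add: prob algebra_simps)
  also have "\<dots> \<le> exp (\<kappa> * \<mu>) * trace_exp I m"
    by (intro mult_right_mono exp_ge_add_one_self) (simp add: tr sum_nonneg sqnorm_nonneg)
  finally show ?thesis unfolding \<kappa>_def .
qed

text \<open>The matrix \<open>K + \<sigma> * (\<Sum>l. z\<^sub>l z\<^sub>l\<^sup>*)\<close>. The shift keeps it positive semidefinite even for \<open>\<sigma> = - 1\<close>.\<close>

definition shifted_gram ::
    "real \<Rightarrow> real \<Rightarrow> nat \<Rightarrow> (nat \<Rightarrow> 'k \<Rightarrow> complex) \<Rightarrow> 'k \<Rightarrow> 'k \<Rightarrow> complex" where
  "shifted_gram K \<sigma> n z =
     (\<lambda>k j. (if k = j then of_real K else 0) + of_real \<sigma> * (\<Sum>l=1..n. z l k * cnj (z l j)))"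

lemma shifted_gram_Suc:
  "shifted_gram K \<sigma> (Suc n) z = add_rank1 (shifted_gram K \<sigma> n z) \<sigma> (z (Suc n))"
  by (simp add: shifted_gram_def add_rank1_def fun_eq_iff algebra_simps)

lemma mat_vec_shifted_gram_0:
  assumes "finite I" "k \<in> I"
  shows "mat_vec I (shifted_gram K \<sigma> 0 z) c k = of_real K * c k"
proof -
  have "mat_vec I (shifted_gram K \<sigma> 0 z) c k = (\<Sum>j\<in>I. if k = j then of_real K * c j else 0)"
    unfolding mat_vec_def shifted_gram_def by (intro sum.cong) auto
  then show ?thesis using assms by simp
qed

lemma moment_1_shifted_gram:
  assumes "finite I"
  shows "moment I (shifted_gram K \<sigma> n z) 1 c = K * sqnorm I c + \<sigma> * (\<Sum>l=1..n. (cmod (ip I c (z l)))\<^sup>2)"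
proof (induction n)
  case 0
  have "ip I (mat_vec I (shifted_gram K \<sigma> 0 z) c) c = ip I (\<lambda>k. of_real K * c k) c"
    by (intro ip_cong) (auto simp: mat_vec_shifted_gram_0[OF assms])
  then show ?case by (simp add: moment_def ip_scale_left ip_self del: of_real_mult flip: of_real_mult)
next
  case (Suc n)
  have "ip I c (z (Suc n)) * ip I (z (Suc n)) c = of_real ((cmod (ip I c (z (Suc n))))\<^sup>2)"
    by (metis cnj_ip complex_norm_square)
  then have "moment I (shifted_gram K \<sigma> (Suc n) z) 1 c
      = moment I (shifted_gram K \<sigma> n z) 1 c + \<sigma> * (cmod (ip I c (z (Suc n))))\<^sup>2"
    by (simp add: moment_def shifted_gram_Suc mat_vec_add_rank1 ip_add_left ip_scale_left mult.assoc)
  then show ?case using Suc by (simp add: algebra_simps)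
qed

lemma psd_shifted_gram:
  assumes "finite I" "\<And>l. l \<in> {1..n} \<Longrightarrow> sqnorm I (z l) \<le> r" "real n * r \<le> K" "\<sigma> = 1 \<or> \<sigma> = - 1"
  shows "psd I (shifted_gram K \<sigma> n z)"
proof -
  have "hermitian I (shifted_gram K \<sigma> n z)"
  proof (induction n)
    case 0
    show ?case by (simp add: hermitian_def shifted_gram_def)
  qed (simp add: shifted_gram_Suc hermitian_add_rank1)
  moreover have "0 \<le> moment I (shifted_gram K \<sigma> n z) 1 c" for c
  proof -
    have "(\<Sum>l=1..n. (cmod (ip I c (z l)))\<^sup>2) \<le> (\<Sum>l=1..n. sqnorm I c * r)"
      using assms(2) by (intro sum_mono order_trans[OF ip_Cauchy_Schwarz] mult_left_mono) (auto simp: sqnorm_nonneg)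
    also have "\<dots> \<le> K * sqnorm I c"
      using mult_right_mono[OF assms(3) sqnorm_nonneg[of I c]] by (simp add: mult_ac)
    finally have "(\<Sum>l=1..n. (cmod (ip I c (z l)))\<^sup>2) \<le> K * sqnorm I c" .
    moreover have "0 \<le> (\<Sum>l=1..n. (cmod (ip I c (z l)))\<^sup>2)" by (simp add: sum_nonneg)
    ultimately show ?thesis
      unfolding moment_1_shifted_gram[OF assms(1)] using assms(4) by auto
  qed
  ultimately show ?thesis by (simp add: psd_def moment_def)
qed

lemma trace_exp_scalar:
  assumes "finite I"
  shows "trace_exp I (shifted_gram K \<sigma> 0 z) = real (card I) * exp K"
proof -
  have "(mat_vec I (shifted_gram K \<sigma> 0 z) ^^ p) c k = of_real (K ^ p) * c k" if "k \<in> I" for p k c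
    using that by (induction p arbitrary: k) (auto simp: mat_vec_shifted_gram_0[OF assms])
  then have "moment I (shifted_gram K \<sigma> 0 z) p c = Re (ip I (\<lambda>k. of_real (K ^ p) * c k) c)" for p c
    unfolding moment_def by (intro arg_cong[where f=Re] ip_cong) auto
  then have "moment I (shifted_gram K \<sigma> 0 z) p c = K ^ p * sqnorm I c" for p c
    by (simp only: ip_scale_left ip_self) (simp del: of_real_power)
  then show ?thesis
    by (simp add: trace_exp_def exp_form_def sqnorm_unit_vec assms exp_def divide_inverse mult.commute)
qed

text \<open>The trace of \<open>exp m\<close> dominates \<open>\<langle>exp m c, c\<rangle>\<close>, which by Jensen's inequality dominates \<open>exp \<langle>m c, c\<rangle>\<close>; the latter
holds termwise in the series.\<close>

lemma exp_moment_le_trace_exp: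
  assumes "finite I" "psd I m" "sqnorm I c = 1"
  shows "exp (moment I m 1 c) \<le> trace_exp I m"
proof -
  have "exp (moment I m 1 c) = (\<Sum>p. (moment I m 1 c) ^ p / fact p)"
    by (simp add: exp_def divide_inverse mult.commute)
  also have "\<dots> \<le> exp_form I m c"
    unfolding exp_form_def
  proof (rule suminf_le)
    show "summable (\<lambda>p. moment I m 1 c ^ p / fact p)"
      using summable_exp[of "moment I m 1 c"] by (simp add: divide_inverse mult.commute)
    show "moment I m 1 c ^ p / fact p \<le> moment I m p c / fact p" for p
      by (intro divide_right_mono moment_ge_power[OF assms(2,3)]) simp
  qed (rule summable_moment[OF assms(1)])
  also have "\<dots> \<le> trace_exp I m"
  proof -
    obtain w where w: "\<And>v. exp_form I m v = (\<Sum>k\<in>I. (cmod (ip I v (w k)))\<^sup>2)"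
      using exp_form_square_root[OF assms(1) psd_hermitian[OF assms(2)]] by blast
    have "exp_form I m c \<le> (\<Sum>k\<in>I. sqnorm I (w k))"
      unfolding w using ip_Cauchy_Schwarz[of I c] assms(3) by (intro sum_mono) simp
    also have "\<dots> = trace_exp I m"
      unfolding trace_exp_def w sqnorm_def
      by (subst sum.swap) (simp add: ip_unit_vec_left assms(1))
    finally show ?thesis .
  qed
  finally show ?thesis .
qed

lemma sum_PiE_Suc:
  fixes F :: "(nat \<Rightarrow> 'b) \<Rightarrow> 'c :: comm_monoid_add"
  shows "(\<Sum>j\<in>{1..Suc n} \<rightarrow>\<^sub>E S. F j) = (\<Sum>j\<in>{1..n} \<rightarrow>\<^sub>E S. \<Sum>i\<in>S. F (j(Suc n := i)))"
proof -
  have eq: "{1..Suc n} \<rightarrow>\<^sub>E S = (\<lambda>(i, j). j(Suc n := i)) ` (S \<times> ({1..n} \<rightarrow>\<^sub>E S))"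
    by (simp add: atLeastAtMostSuc_conv PiE_insert_eq)
  have inj: "inj_on (\<lambda>(i, j). j(Suc n := i)) (S \<times> ({1..n} \<rightarrow>\<^sub>E S))"
    by (rule inj_combinator) simp
  have "(\<Sum>j\<in>{1..Suc n} \<rightarrow>\<^sub>E S. F j) = (\<Sum>(i, j)\<in>S \<times> ({1..n} \<rightarrow>\<^sub>E S). F (j(Suc n := i)))"
    unfolding eq sum.reindex[OF inj] by (intro sum.cong) auto
  also have "\<dots> = (\<Sum>i\<in>S. \<Sum>j\<in>{1..n} \<rightarrow>\<^sub>E S. F (j(Suc n := i)))"
    by (rule sum.cartesian_product[symmetric])
  also have "\<dots> = (\<Sum>j\<in>{1..n} \<rightarrow>\<^sub>E S. \<Sum>i\<in>S. F (j(Suc n := i)))"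
    by (rule sum.swap)
  finally show ?thesis .
qed

text \<open>The expectation over \<open>n\<close> independent draws is written as a sum over all tuples of outcomes, weighted by
products of probabilities. Conditioning on all but the last draw means fixing the other entries of
the tuple.\<close>

lemma expected_trace_exp_le:
  assumes "finite I" "finite S"
    and prob: "\<And>i. i \<in> S \<Longrightarrow> 0 \<le> \<rho> i" "(\<Sum>i\<in>S. \<rho> i) = 1"
    and y: "\<And>i. i \<in> S \<Longrightarrow> sqnorm I (y i) \<le> r" "0 < r"
    and mean: "\<And>w. \<sigma> * (\<Sum>i\<in>S. \<rho> i * (cmod (ip I w (y i)))\<^sup>2) \<le> \<sigma> * (\<mu> * sqnorm I w)"
    and "\<sigma> = 1 \<or> \<sigma> = - 1"
    and "real n * r \<le> K"
  shows "(\<Sum>j\<in>{1..n} \<rightarrow>\<^sub>E S. (\<Prod>l=1..n. \<rho> (j l)) * trace_exp I (shifted_gram K \<sigma> n (\<lambda>l. y (j l))))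
    \<le> exp (real n * ((exp (\<sigma> * r) - 1) / r * \<mu>)) * (real (card I) * exp K)"
  using assms(9)
proof (induction n)
  case 0
  then show ?case by (simp add: trace_exp_scalar assms(1))
next
  case (Suc n)
  define q where "q = exp ((exp (\<sigma> * r) - 1) / r * \<mu>)"
  let ?T = "\<lambda>n j. trace_exp I (shifted_gram K \<sigma> n (\<lambda>l. y (j l)))"
  have nr: "real n * r \<le> K" using Suc.prems y(2) by (simp add: algebra_simps)
  have upd: "shifted_gram K \<sigma> (Suc n) (\<lambda>l. y ((j(Suc n := i)) l))
      = add_rank1 (shifted_gram K \<sigma> n (\<lambda>l. y (j l))) \<sigma> (y i)" for i j
    by (simp add: shifted_gram_def add_rank1_def fun_eq_iff algebra_simps)
  have "(\<Sum>j\<in>{1..Suc n} \<rightarrow>\<^sub>E S. (\<Prod>l=1..Suc n. \<rho> (j l)) * ?T (Suc n) j)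
    = (\<Sum>j\<in>{1..n} \<rightarrow>\<^sub>E S. (\<Prod>l=1..n. \<rho> (j l)) *
         (\<Sum>i\<in>S. \<rho> i * trace_exp I (add_rank1 (shifted_gram K \<sigma> n (\<lambda>l. y (j l))) \<sigma> (y i))))"
    unfolding sum_PiE_Suc upd by (simp add: sum_distrib_left mult_ac)
  also have "\<dots> \<le> (\<Sum>j\<in>{1..n} \<rightarrow>\<^sub>E S. (\<Prod>l=1..n. \<rho> (j l)) * (q * ?T n j))"
  proof (intro sum_mono mult_left_mono)
    fix j assume j: "j \<in> {1..n} \<rightarrow>\<^sub>E S"
    show "0 \<le> (\<Prod>l=1..n. \<rho> (j l))" using j prob(1) by (intro prod_nonneg) (auto simp: PiE_def Pi_def)
    have "psd I (shifted_gram K \<sigma> n (\<lambda>l. y (j l)))"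
      using j y(1) by (intro psd_shifted_gram[OF assms(1) _ nr assms(8)]) (auto simp: PiE_def Pi_def)
    moreover have "psd I (add_rank1 (shifted_gram K \<sigma> n (\<lambda>l. y (j l))) \<sigma> (y i))" if "i \<in> S" for i
      unfolding upd[symmetric]
      using j y(1) that by (intro psd_shifted_gram[OF assms(1) _ Suc.prems assms(8)]) (auto simp: PiE_def Pi_def)
    ultimately show "(\<Sum>i\<in>S. \<rho> i * trace_exp I (add_rank1 (shifted_gram K \<sigma> n (\<lambda>l. y (j l))) \<sigma> (y i)))
        \<le> q * ?T n j"
      unfolding q_def using assms by (intro trace_exp_average_update) auto
  qed
  also have "\<dots> = q * (\<Sum>j\<in>{1..n} \<rightarrow>\<^sub>E S. (\<Prod>l=1..n. \<rho> (j l)) * ?T n j)"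
    by (simp add: sum_distrib_left mult_ac)
  also have "\<dots> \<le> q * (exp (real n * ((exp (\<sigma> * r) - 1) / r * \<mu>)) * (real (card I) * exp K))"
    using Suc.IH[OF nr] by (simp add: q_def)
  also have "\<dots> = exp (real (Suc n) * ((exp (\<sigma> * r) - 1) / r * \<mu>)) * (real (card I) * exp K)"
    unfolding q_def of_nat_Suc distrib_right exp_add by simp
  finally show ?case .
qed

text \<open>Markov's inequality for the trace of the exponential: in the event on the left, some unit vector \<open>c\<close>
forces this trace to be at least \<open>exp (K + \<tau>)\<close>. The factor \<open>exp K\<close> of the shift appears on both sides.\<close>

lemma matrix_Chernoff_rank1:
  assumes "finite I" "finite S"
    and prob: "\<And>i. i \<in> S \<Longrightarrow> 0 \<le> \<rho> i" "(\<Sum>i\<in>S. \<rho> i) = 1"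
    and y: "\<And>i. i \<in> S \<Longrightarrow> sqnorm I (y i) \<le> r" "0 < r"
    and mean: "\<And>w. \<sigma> * (\<Sum>i\<in>S. \<rho> i * (cmod (ip I w (y i)))\<^sup>2) \<le> \<sigma> * (\<mu> * sqnorm I w)"
    and "\<sigma> = 1 \<or> \<sigma> = - 1"
  shows "(\<Sum>j | j \<in> {1..n} \<rightarrow>\<^sub>E S \<and> (\<exists>c. sqnorm I c = 1 \<and> \<tau> \<le> \<sigma> * (\<Sum>l=1..n. (cmod (ip I c (y (j l))))\<^sup>2)).
           \<Prod>l=1..n. \<rho> (j l))
    \<le> real (card I) * exp (real n * ((exp (\<sigma> * r) - 1) / r * \<mu>) - \<tau>)"
    (is "sum ?p ?bad \<le> _")
proof -
  define K where "K = real n * r"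
  let ?T = "\<lambda>j. trace_exp I (shifted_gram K \<sigma> n (\<lambda>l. y (j l)))"
  have p0: "0 \<le> ?p j" if "j \<in> {1..n} \<rightarrow>\<^sub>E S" for j
    using that prob(1) by (intro prod_nonneg) (auto simp: PiE_def Pi_def)
  have psd: "psd I (shifted_gram K \<sigma> n (\<lambda>l. y (j l)))" if "j \<in> {1..n} \<rightarrow>\<^sub>E S" for j
    using that y(1) by (intro psd_shifted_gram[OF assms(1) _ _ assms(8)]) (auto simp: PiE_def Pi_def K_def)
  have T0: "0 \<le> ?T j" if "j \<in> {1..n} \<rightarrow>\<^sub>E S" for j
    unfolding trace_exp_def by (intro sum_nonneg exp_form_nonneg assms(1) psd that)
  have "exp (K + \<tau>) * sum ?p ?bad \<le> (\<Sum>j\<in>?bad. ?p j * ?T j)"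
    unfolding sum_distrib_left[of "exp (K + \<tau>)"]
  proof (rule sum_mono)
    fix j assume "j \<in> ?bad"
    then obtain c where j: "j \<in> {1..n} \<rightarrow>\<^sub>E S" and c: "sqnorm I c = 1"
      "\<tau> \<le> \<sigma> * (\<Sum>l=1..n. (cmod (ip I c (y (j l))))\<^sup>2)" by blast
    have "exp (K + \<tau>) \<le> exp (moment I (shifted_gram K \<sigma> n (\<lambda>l. y (j l))) 1 c)"
      unfolding moment_1_shifted_gram[OF assms(1)] using c by simp
    also have "\<dots> \<le> ?T j" by (rule exp_moment_le_trace_exp[OF assms(1) psd[OF j] c(1)])
    finally show "exp (K + \<tau>) * ?p j \<le> ?p j * ?T j"
      by (subst (2) mult.commute) (rule mult_right_mono[OF _ p0[OF j]])
  qed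
  also have "\<dots> \<le> (\<Sum>j\<in>{1..n} \<rightarrow>\<^sub>E S. ?p j * ?T j)"
    by (intro sum_mono2 finite_PiE mult_nonneg_nonneg p0 T0) (auto simp: assms(2))
  also have "\<dots> \<le> exp (real n * ((exp (\<sigma> * r) - 1) / r * \<mu>)) * (real (card I) * exp K)"
    using assms by (intro expected_trace_exp_le) (auto simp: K_def)
  also have "\<dots> = exp (K + \<tau>) * (real (card I) * exp (real n * ((exp (\<sigma> * r) - 1) / r * \<mu>) - \<tau>))"
    by (simp add: exp_add exp_diff)
  finally show ?thesis by simp
qed

section \<open>Coefficient vectors and independent indices\<close>

lemma sum_fun_apply: "(\<Sum>k\<in>A. g k) x = (\<Sum>k\<in>A. g k (x :: 'a) :: complex)"
  by (induction A rule: infinite_finite_induct) auto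

lemma span_image_lincomb:
  fixes \<eta> :: "'k \<Rightarrow> 'a \<Rightarrow> complex"
  assumes "finite I" "inj_on \<eta> I"
  shows "cfun.span (\<eta> ` I) = range (\<lambda>c x. \<Sum>k\<in>I. c k * \<eta> k x)"
proof (intro set_eqI iffI)
  fix f assume "f \<in> cfun.span (\<eta> ` I)"
  then obtain u where "f = (\<Sum>v\<in>\<eta> ` I. (\<lambda>x. u v * v x))"
    using cfun.span_finite[of "\<eta> ` I"] assms(1) by auto
  then have "f = (\<lambda>x. \<Sum>k\<in>I. u (\<eta> k) * \<eta> k x)"
    by (simp add: sum.reindex[OF assms(2)] fun_eq_iff sum_fun_apply)
  then show "f \<in> range (\<lambda>c x. \<Sum>k\<in>I. c k * \<eta> k x)" by (intro image_eqI[of _ _ "\<lambda>k. u (\<eta> k)"]) auto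
next
  fix f assume "f \<in> range (\<lambda>c x. \<Sum>k\<in>I. c k * \<eta> k x)"
  then obtain c where f: "f = (\<lambda>x. \<Sum>k\<in>I. c k * \<eta> k x)" by blast
  have "f = (\<Sum>k\<in>I. (\<lambda>x. c k * \<eta> k x))" by (simp add: f fun_eq_iff sum_fun_apply)
  then show "f \<in> cfun.span (\<eta> ` I)"
    by (auto intro!: cfun.span_sum cfun.span_scale intro: cfun.span_base)
qed

lemma integrable_mult_cnj:
  assumes "square_integrable \<nu> f" "square_integrable \<nu> g"
  shows "integrable \<nu> (\<lambda>x. f x * cnj (g x))"
proof (rule Bochner_Integration.integrable_bound)
  show "integrable \<nu> (\<lambda>x. (cmod (f x))\<^sup>2 + (cmod (g x))\<^sup>2)"
    using assms by (simp add: square_integrable_def)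
  show "(\<lambda>x. f x * cnj (g x)) \<in> borel_measurable \<nu>"
  proof -
    have f: "f \<in> borel_measurable \<nu>" and g: "g \<in> borel_measurable \<nu>"
      using assms by (simp_all add: square_integrable_def)
    have "cnj \<in> borel_measurable borel"
      by (intro borel_measurable_continuous_onI continuous_intros)
    from borel_measurable_times[OF f measurable_compose[OF g this]] show ?thesis .
  qed
  have "norm (f x * cnj (g x)) \<le> norm ((cmod (f x))\<^sup>2 + (cmod (g x))\<^sup>2)" for x
  proof -
    have "0 \<le> cmod (f x) * cmod (g x)" by simp
    then have "cmod (f x) * cmod (g x) \<le> (cmod (f x))\<^sup>2 + (cmod (g x))\<^sup>2"
      using sum_squares_bound[of "cmod (f x)" "cmod (g x)"] by linarith
    then show ?thesis by (simp add: norm_mult)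
  qed
  then show "AE x in \<nu>. norm (f x * cnj (g x)) \<le> norm ((cmod (f x))\<^sup>2 + (cmod (g x))\<^sup>2)" by simp
qed

lemma L2_norm_lincomb:
  assumes "finite I" and sq: "\<And>k. k \<in> I \<Longrightarrow> square_integrable \<nu> (\<eta> k)"
    and on: "\<And>k l. k \<in> I \<Longrightarrow> l \<in> I \<Longrightarrow> L2_inner \<nu> (\<eta> k) (\<eta> l) = (if k = l then 1 else 0)"
  shows "(L2_norm \<nu> (\<lambda>x. \<Sum>k\<in>I. c k * \<eta> k x))\<^sup>2 = sqnorm I c"
proof -
  let ?f = "\<lambda>x. \<Sum>k\<in>I. c k * \<eta> k x"
  have "complex_of_real (LINT x|\<nu>. (cmod (?f x))\<^sup>2) = (LINT x|\<nu>. ?f x * cnj (?f x))"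
    unfolding complex_norm_square[symmetric] by (rule integral_complex_of_real[symmetric])
  also have "\<dots> = (LINT x|\<nu>. (\<Sum>k\<in>I. \<Sum>l\<in>I. c k * cnj (c l) * (\<eta> k x * cnj (\<eta> l x))))"
    by (intro Bochner_Integration.integral_cong refl) (simp add: sum_product mult_ac)
  also have "\<dots> = (\<Sum>k\<in>I. \<Sum>l\<in>I. c k * cnj (c l) * L2_inner \<nu> (\<eta> k) (\<eta> l))"
    unfolding L2_inner_def
    by (simp add: Bochner_Integration.integral_sum integrable_mult_cnj sq)
  also have "\<dots> = (\<Sum>k\<in>I. \<Sum>l\<in>I. if k = l then c k * cnj (c l) else 0)"
    by (intro sum.cong refl) (simp add: on)
  also have "\<dots> = ip I c c" using assms(1) by (simp add: ip_def)
  finally have "(LINT x|\<nu>. (cmod (?f x))\<^sup>2) = sqnorm I c"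
    unfolding ip_self of_real_eq_iff .
  then show ?thesis unfolding L2_norm_def by (simp add: sqnorm_nonneg)
qed

text \<open>An event that is determined by the values of \<open>n\<close> indices is the finite disjoint union of the
events that prescribe all these values, and each of those is an intersection of independent events. This yields
both its measurability and its probability.\<close>

lemma measure_iid_indices:
  fixes Q :: "(nat \<Rightarrow> nat) \<Rightarrow> bool"
  assumes iid: "iid_indices P n M \<rho> J" and "0 < n"
    and Q: "\<And>j j'. (\<And>l. l \<in> {1..n} \<Longrightarrow> j l = j' l) \<Longrightarrow> Q j \<longleftrightarrow> Q j'"
  shows "measure P {w \<in> space P. Q (\<lambda>l. J l w)} = (\<Sum>j | j \<in> {1..n} \<rightarrow>\<^sub>E {1..M} \<and> Q j. \<Prod>l=1..n. \<rho> (j l))"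
proof -
  interpret prob_space P using iid by (simp add: iid_indices_def)
  have ind: "indep_vars (\<lambda>_. count_space {1..M}) J {1..n}" using iid by (simp add: iid_indices_def)
  have J: "J l \<in> measurable P (count_space {1..M})" if "l \<in> {1..n}" for l
    using ind that by (auto simp: indep_vars_def)
  define T where "T = {j \<in> {1..n} \<rightarrow>\<^sub>E {1..M}. Q j}"
  define E where "E = (\<lambda>j. \<Inter>l\<in>{1..n}. J l -` {j l} \<inter> space P)"
  have fin: "finite T" unfolding T_def by (rule finite_subset[of _ "{1..n} \<rightarrow>\<^sub>E {1..M}"]) (auto intro: finite_PiE)
  have sets: "J l -` {j l} \<inter> space P \<in> sets P" if "j \<in> T" "l \<in> {1..n}" for j l
    using J[OF that(2)] that by (intro measurable_sets) (auto simp: T_def)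
  have Esets: "E j \<in> events" if "j \<in> T" for j
    unfolding E_def using \<open>0 < n\<close> sets[OF that] by (intro sets.finite_INT) auto
  have prob_E: "prob (E j) = (\<Prod>l=1..n. \<rho> (j l))" if j: "j \<in> T" for j
  proof -
    have "prob (E j) = (\<Prod>l\<in>{1..n}. prob (J l -` {j l} \<inter> space P))"
      unfolding E_def using \<open>0 < n\<close> j by (intro indep_varsD[OF ind]) (auto simp: T_def)
    also have "\<dots> = (\<Prod>l=1..n. \<rho> (j l))"
    proof (rule prod.cong[OF refl])
      fix l assume l: "l \<in> {1..n}"
      then have "j l \<in> {1..M}" using j by (auto simp: T_def)
      moreover have "J l -` {j l} \<inter> space P = {w \<in> space P. J l w = j l}" by auto
      ultimately show "prob (J l -` {j l} \<inter> space P) = \<rho> (j l)"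
        using iid l by (simp add: iid_indices_def)
    qed
    finally show ?thesis .
  qed
  have "{w \<in> space P. Q (\<lambda>l. J l w)} = (\<Union>j\<in>T. E j)"
  proof (intro set_eqI iffI)
    fix w assume w: "w \<in> {w \<in> space P. Q (\<lambda>l. J l w)}"
    define j where "j = restrict (\<lambda>l. J l w) {1..n}"
    have "Q j" using w Q[of j "\<lambda>l. J l w"] by (simp add: j_def)
    moreover have "j \<in> {1..n} \<rightarrow>\<^sub>E {1..M}"
      unfolding j_def using measurable_space[OF J] w by auto
    ultimately have "j \<in> T" by (simp add: T_def)
    moreover have "w \<in> E j" using w \<open>0 < n\<close> by (auto simp: E_def j_def)
    ultimately show "w \<in> (\<Union>j\<in>T. E j)" by blast
  next
    fix w assume "w \<in> (\<Union>j\<in>T. E j)"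
    then obtain j where "j \<in> T" and w: "w \<in> E j" by blast
    have "w \<in> space P" "\<And>l. l \<in> {1..n} \<Longrightarrow> J l w = j l"
      using w \<open>0 < n\<close> by (auto simp: E_def Suc_le_eq)
    then show "w \<in> {w \<in> space P. Q (\<lambda>l. J l w)}"
      using \<open>j \<in> T\<close> Q[of "\<lambda>l. J l w" j] by (simp add: T_def)
  qed
  moreover have "disjoint_family_on E T"
  proof (unfold disjoint_family_on_def, intro ballI impI)
    fix i j assume ij: "i \<in> T" "j \<in> T" "i \<noteq> j"
    then obtain l where "l \<in> {1..n}" "i l \<noteq> j l"
      unfolding T_def by (metis (no_types, lifting) PiE_ext mem_Collect_eq)
    then show "E i \<inter> E j = {}" unfolding E_def by auto
  qed
  ultimately have "prob {w \<in> space P. Q (\<lambda>l. J l w)} = (\<Sum>j\<in>T. prob (E j))"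
    using fin Esets by (simp add: finite_measure_finite_Union image_subset_iff)
  then show ?thesis unfolding T_def using prob_E by (simp add: T_def)
qed

section \<open>Spectral bounds for the subsampled quadratic form\<close>

lemma exp_half_less: "exp (1 / 2 :: real) < 5 / 3"
proof -
  have "(exp (1 / 2 :: real))\<^sup>2 = exp 1" by (simp add: power2_eq_square flip: exp_add)
  also have "\<dots> < 272 / 100" by (rule e_less_272)
  also have "\<dots> < (5 / 3 :: real)\<^sup>2" by (simp add: power2_eq_square)
  finally show ?thesis by (rule power2_less_imp_less) simp
qed

lemma exp_minus_half_less: "exp (- (1 / 2) :: real) < 2 / 3"
proof -
  have "1 + (1 / 2) < exp (1 / 2 :: real)"
    using exp_lower_Taylor_quadratic[of "1 / 2 :: real"] by (simp add: power2_eq_square)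
  then show ?thesis by (simp add: exp_minus field_simps)
qed

text \<open>The common factor \<open>\<theta>\<close> scales the summands so that their squared norms are at most \<open>r = 1/2\<close>. At this \<open>r\<close>
the exponents of the upper and the lower Chernoff bound are \<open>(2 * exp (1/2) - 7/2) * \<theta> * B\<close> and
\<open>(2 * exp (- 1/2) - 3/2) * \<theta> * A\<close>. Both coefficients are smaller than \<open>- 1/6\<close>, while \<open>\<theta> * A\<close> and
\<open>\<theta> * B\<close> are at least \<open>6 * (ln |I| + t)\<close> by the hypothesis on \<open>n\<close>; this is where the constant 12
suffices. The prefactor \<open>|I|\<close> cancels against \<open>ln |I|\<close>, and each tail contributes less than
\<open>exp (- t)\<close>.\<close>

lemma subsampling_failure_weight:
  fixes \<eta> :: "'k \<Rightarrow> 'a \<Rightarrow> complex"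
  assumes fin: "finite I" and "I \<noteq> {}" and C: "0 < C" and AB: "0 < A" "A \<le> B" and t: "0 < t"
    and \<omega>: "\<And>i. i \<in> {1..M} \<Longrightarrow> 0 \<le> \<omega> i"
    and frame: "\<And>c. A * sqnorm I c \<le> (\<Sum>i=1..M. \<omega> i * (cmod (\<Sum>k\<in>I. c k * \<eta> k (x i)))\<^sup>2)"
       "\<And>c. (\<Sum>i=1..M. \<omega> i * (cmod (\<Sum>k\<in>I. c k * \<eta> k (x i)))\<^sup>2) \<le> B * sqnorm I c"
    and n: "real n \<ge> 12 * B / (A * C) * real (card I) * (ln (real (card I)) + t)"
    and \<rho>: "\<And>i. i \<in> {1..M} \<Longrightarrow> 0 \<le> \<rho> i" "(\<Sum>i=1..M. \<rho> i) = 1"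
    and \<rho>_ge: "\<And>i. i \<in> {1..M} \<Longrightarrow> \<rho> i \<ge> C * \<omega> i * (\<Sum>k\<in>I. (cmod (\<eta> k (x i)))\<^sup>2) /
                             (\<Sum>j=1..M. \<omega> j * (\<Sum>k\<in>I. (cmod (\<eta> k (x j)))\<^sup>2))"
  shows "(\<Sum>j | j \<in> {1..n} \<rightarrow>\<^sub>E {1..M} \<and>
        \<not> (\<forall>c. 1 / 2 * A * sqnorm I c \<le> subsampled_sum n x \<omega> \<rho> j (\<lambda>z. \<Sum>k\<in>I. c k * \<eta> k z) \<and>
               subsampled_sum n x \<omega> \<rho> j (\<lambda>z. \<Sum>k\<in>I. c k * \<eta> k z) \<le> 3 / 2 * B * sqnorm I c).
        \<Prod>l=1..n. \<rho> (j l)) < 2 * exp (- t)"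
    (is "sum ?p ?bad < _")
proof -
  define d where "d = real (card I)"
  have d1: "1 \<le> d" using fin \<open>I \<noteq> {}\<close> unfolding d_def by (simp add: Suc_le_eq card_gt_0_iff)
  define L where "L = ln d + t"
  have L: "0 < L" using d1 t by (simp add: L_def add_nonneg_pos)
  have B: "0 < B" using AB by simp
  have n': "12 * B / (A * C) * d * L \<le> real n" using n by (simp add: d_def L_def)
  have "0 < 12 * B / (A * C) * d * L" using B AB C d1 L by simp
  then have npos: "0 < real n" using n' by linarith
  define s where "s = (\<lambda>i. \<Sum>k\<in>I. (cmod (\<eta> k (x i)))\<^sup>2)"
  define R where "R = (\<Sum>j=1..M. \<omega> j * s j)"
  have s0: "0 \<le> s i" for i by (simp add: s_def sum_nonneg)
  \<comment> \<open>The normalising constant \<open>R\<close> is the trace of the MZ form, hence between \<open>A * |I|\<close> and \<open>B * |I|\<close>.\<close>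
  have R_eq: "R = (\<Sum>k\<in>I. \<Sum>i=1..M. \<omega> i * (cmod (\<Sum>l\<in>I. unit_vec k l * \<eta> l (x i)))\<^sup>2)"
  proof -
    have "(\<Sum>l\<in>I. unit_vec k l * \<eta> l z) = \<eta> k z" if "k \<in> I" for k z
      using that fin unfolding unit_vec_def by (simp add: if_distrib[where f="\<lambda>a. a * _"] cong: if_cong)
    then show ?thesis
      unfolding R_def s_def sum_distrib_left by (subst sum.swap) simp
  qed
  have R_le: "R \<le> B * d"
  proof -
    have "R \<le> (\<Sum>k\<in>I. B * sqnorm I (unit_vec k))" unfolding R_eq by (intro sum_mono frame)
    then show ?thesis by (simp add: sqnorm_unit_vec fin d_def mult.commute)
  qed
  have R_pos: "0 < R"
  proof -
    have "(\<Sum>k\<in>I. A * sqnorm I (unit_vec k)) \<le> R" unfolding R_eq by (intro sum_mono frame)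
    then have "A * d \<le> R" by (simp add: sqnorm_unit_vec fin d_def mult.commute)
    moreover have "0 < A * d" using AB d1 by simp
    ultimately show ?thesis by linarith
  qed
  have \<rho>_s: "C * (\<omega> i * s i) \<le> \<rho> i * R" if "i \<in> {1..M}" for i
  proof -
    have "C * \<omega> i * s i / R \<le> \<rho> i" using \<rho>_ge[OF that] by (simp only: R_def s_def)
    then show ?thesis using R_pos by (simp add: pos_divide_le_eq mult.assoc)
  qed
  define \<theta> where "\<theta> = real n * C / (2 * B * d)"
  have \<theta>: "0 < \<theta>" using npos C B d1 by (simp add: \<theta>_def)
  define a where "a = (\<lambda>i. \<theta> * (\<omega> i / (real n * \<rho> i)))"
  have a0: "0 \<le> a i" if "i \<in> {1..M}" for i
    using \<theta> \<omega>[OF that] \<rho>(1)[OF that] by (simp add: a_def)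
  define y where "y = (\<lambda>i k. of_real (sqrt (a i)) * cnj (\<eta> k (x i)))"
  have ip_y: "(cmod (ip I c (y i)))\<^sup>2 = a i * (cmod (\<Sum>k\<in>I. c k * \<eta> k (x i)))\<^sup>2" if "i \<in> {1..M}" for c i
    unfolding y_def ip_scale_right using a0[OF that]
    by (simp add: ip_def norm_mult power_mult_distrib)
  have y_le: "sqnorm I (y i) \<le> 1 / 2" if i: "i \<in> {1..M}" for i
  proof (cases "\<rho> i = 0")
    case True
    then show ?thesis by (simp add: y_def a_def sqnorm_def)
  next
    case False
    then have pos: "0 < \<rho> i" using \<rho>(1)[OF i] by simp
    have "sqnorm I (y i) = a i * s i"
      unfolding y_def sqnorm_scale using a0[OF i] by (simp add: sqnorm_def s_def)
    also have "\<dots> = C * (\<omega> i * s i) / (2 * B * d * \<rho> i)"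
      using npos by (simp add: a_def \<theta>_def)
    also have "\<dots> \<le> \<rho> i * (B * d) / (2 * B * d * \<rho> i)"
      using order_trans[OF \<rho>_s[OF i] mult_left_mono[OF R_le \<rho>(1)[OF i]]] B d1 pos
      by (intro divide_right_mono) auto
    also have "\<dots> = 1 / 2" using B d1 pos by simp
    finally show ?thesis .
  qed
  \<comment> \<open>The weights \<open>\<rho> i\<close> cancel. If \<open>\<rho> i = 0\<close>, the lower bound on \<open>\<rho> i\<close> forces the \<open>i\<close>-th term of the MZ form to vanish.\<close>
  have mean: "(\<Sum>i=1..M. \<rho> i * (cmod (ip I c (y i)))\<^sup>2)
      = \<theta> / real n * (\<Sum>i=1..M. \<omega> i * (cmod (\<Sum>k\<in>I. c k * \<eta> k (x i)))\<^sup>2)" for c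
    unfolding sum_distrib_left
  proof (rule sum.cong[OF refl])
    fix i assume i: "i \<in> {1..M}"
    show "\<rho> i * (cmod (ip I c (y i)))\<^sup>2 = \<theta> / real n * (\<omega> i * (cmod (\<Sum>k\<in>I. c k * \<eta> k (x i)))\<^sup>2)"
    proof (cases "\<rho> i = 0")
      case True
      have "\<omega> i * s i = 0"
      proof -
        have "C * (\<omega> i * s i) \<le> 0" using \<rho>_s[OF i] True by simp
        moreover have "0 \<le> \<omega> i * s i" using \<omega>[OF i] s0 by simp
        ultimately show ?thesis using C by (metis antisym_conv mult_le_0_iff not_less)
      qed
      then have "\<omega> i = 0 \<or> (\<forall>k\<in>I. \<eta> k (x i) = 0)"
        using fin by (auto simp: s_def sum_nonneg_eq_0_iff)
      then have "\<omega> i * (cmod (\<Sum>k\<in>I. c k * \<eta> k (x i)))\<^sup>2 = 0" by auto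
      then show ?thesis using True by simp
    next
      case False
      then show ?thesis unfolding ip_y[OF i] a_def by simp
    qed
  qed
  have sub: "(\<Sum>l=1..n. (cmod (ip I c (y (j l))))\<^sup>2) = \<theta> * subsampled_sum n x \<omega> \<rho> j (\<lambda>z. \<Sum>k\<in>I. c k * \<eta> k z)"
    if "j \<in> {1..n} \<rightarrow>\<^sub>E {1..M}" for c j
    unfolding subsampled_sum_def sum_distrib_left
  proof (rule sum.cong[OF refl])
    fix l assume "l \<in> {1..n}"
    then have "j l \<in> {1..M}" using that by blast
    then show "(cmod (ip I c (y (j l))))\<^sup>2
       = \<theta> * (\<omega> (j l) / (real n * \<rho> (j l)) * (cmod (\<Sum>k\<in>I. c k * \<eta> k (x (j l))))\<^sup>2)"
      unfolding ip_y[OF \<open>j l \<in> {1..M}\<close>] a_def by simp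
  qed
  have p0: "0 \<le> ?p j" if "j \<in> {1..n} \<rightarrow>\<^sub>E {1..M}" for j
    using that \<rho>(1) by (intro prod_nonneg) (auto simp: PiE_def Pi_def)
  define bad where "bad = (\<lambda>\<sigma> \<tau>. {j \<in> {1..n} \<rightarrow>\<^sub>E {1..M}.
      \<exists>c. sqnorm I c = 1 \<and> \<tau> \<le> \<sigma> * (\<Sum>l=1..n. (cmod (ip I c (y (j l))))\<^sup>2)})"
  have finb: "finite (bad \<sigma> \<tau>)" for \<sigma> \<tau> :: real
    unfolding bad_def by (rule finite_subset[of _ "{1..n} \<rightarrow>\<^sub>E {1..M}"]) (auto intro: finite_PiE)
  have chernoff: "sum ?p (bad \<sigma> \<tau>) \<le> d * exp (real n * ((exp (\<sigma> * (1/2)) - 1) / (1/2) * \<mu>) - \<tau>)"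
    if "\<sigma> = 1 \<or> \<sigma> = - 1"
      "\<And>w. \<sigma> * (\<Sum>i\<in>{1..M}. \<rho> i * (cmod (ip I w (y i)))\<^sup>2) \<le> \<sigma> * (\<mu> * sqnorm I w)" for \<sigma> \<tau> \<mu> :: real
    unfolding bad_def d_def
    by (rule matrix_Chernoff_rank1) (use fin \<rho> y_le that in auto)
  have dL: "d * exp (- L) = exp (- t)"
  proof -
    have "exp (- L) = inverse d * exp (- t)"
      using d1 unfolding L_def by (simp only: minus_add_distrib exp_add exp_minus exp_ln)
    then show ?thesis using d1 by simp
  qed
  have \<theta>A: "6 * L \<le> \<theta> * A"
  proof -
    have "6 * L = (12 * B / (A * C) * d * L) * (C * A / (2 * B * d))"
      using AB B C d1 by (simp add: field_simps)
    also have "\<dots> \<le> real n * (C * A / (2 * B * d))"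
      using n' AB B C d1 by (intro mult_right_mono) auto
    finally show ?thesis by (simp add: \<theta>_def)
  qed
  have \<theta>B: "6 * L \<le> \<theta> * B" using \<theta>A mult_left_mono[OF AB(2), of \<theta>] \<theta> by linarith
  have upper: "sum ?p (bad 1 (3 / 2 * (\<theta> * B))) < exp (- t)"
  proof -
    have "sum ?p (bad 1 (3 / 2 * (\<theta> * B)))
       \<le> d * exp (real n * ((exp (1 * (1/2)) - 1) / (1/2) * (\<theta> * B / real n)) - 3 / 2 * (\<theta> * B))"
    proof (rule chernoff)
      show "1 * (\<Sum>i\<in>{1..M}. \<rho> i * (cmod (ip I w (y i)))\<^sup>2) \<le> 1 * (\<theta> * B / real n * sqnorm I w)" for w
        using mult_left_mono[OF frame(2)[of w], of "\<theta> / real n"] \<theta> npos unfolding mean by (simp add: mult.assoc)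
    qed simp
    also have "real n * ((exp (1 * (1/2)) - 1) / (1/2) * (\<theta> * B / real n)) - 3 / 2 * (\<theta> * B)
       = (2 * exp (1/2) - 7 / 2) * (\<theta> * B)"
      using npos by (simp add: algebra_simps)
    also have "d * exp ((2 * exp (1/2) - 7 / 2) * (\<theta> * B)) < d * exp (- L)"
    proof -
      have "(2 * exp (1/2) - 7 / 2) * (\<theta> * B) < (- (1 / 6)) * (\<theta> * B)"
        using exp_half_less \<theta> B by (intro mult_strict_right_mono) auto
      also have "\<dots> \<le> - L" using \<theta>B by simp
      finally show ?thesis using d1 by simp
    qed
    finally show ?thesis unfolding dL .
  qed
  have lower: "sum ?p (bad (- 1) (- (1 / 2) * (\<theta> * A))) < exp (- t)"
  proof -
    have "sum ?p (bad (- 1) (- (1 / 2) * (\<theta> * A)))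
       \<le> d * exp (real n * ((exp (- 1 * (1/2)) - 1) / (1/2) * (\<theta> * A / real n)) - (- (1 / 2) * (\<theta> * A)))"
    proof (rule chernoff)
      show "- 1 * (\<Sum>i\<in>{1..M}. \<rho> i * (cmod (ip I w (y i)))\<^sup>2) \<le> - 1 * (\<theta> * A / real n * sqnorm I w)" for w
        using mult_left_mono[OF frame(1)[of w], of "\<theta> / real n"] \<theta> npos unfolding mean by (simp add: mult.assoc)
    qed simp
    also have "real n * ((exp (- 1 * (1/2)) - 1) / (1/2) * (\<theta> * A / real n)) - (- (1 / 2) * (\<theta> * A))
       = (2 * exp (- (1/2)) - 3 / 2) * (\<theta> * A)"
      using npos by (simp add: algebra_simps)
    also have "d * exp ((2 * exp (- (1/2)) - 3 / 2) * (\<theta> * A)) < d * exp (- L)"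
    proof -
      have "(2 * exp (- (1/2)) - 3 / 2) * (\<theta> * A) < (- (1 / 6)) * (\<theta> * A)"
        using exp_minus_half_less \<theta> AB by (intro mult_strict_right_mono) auto
      also have "\<dots> \<le> - L" using \<theta>A by simp
      finally show ?thesis using d1 by simp
    qed
    finally show ?thesis unfolding dL .
  qed
  \<comment> \<open>A violated inequality is homogeneous in \<open>c\<close>, so it is violated at a unit vector.\<close>
  have "?bad \<subseteq> bad 1 (3 / 2 * (\<theta> * B)) \<union> bad (- 1) (- (1 / 2) * (\<theta> * A))"
  proof
    fix j assume "j \<in> ?bad"
    then obtain c where j: "j \<in> {1..n} \<rightarrow>\<^sub>E {1..M}"
      and c: "\<not> (1 / 2 * A * sqnorm I c \<le> subsampled_sum n x \<omega> \<rho> j (\<lambda>z. \<Sum>k\<in>I. c k * \<eta> k z) \<and>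
               subsampled_sum n x \<omega> \<rho> j (\<lambda>z. \<Sum>k\<in>I. c k * \<eta> k z) \<le> 3 / 2 * B * sqnorm I c)" by blast
    let ?S = "\<lambda>c. \<Sum>l=1..n. (cmod (ip I c (y (j l))))\<^sup>2"
    have c': "?S c < 1 / 2 * (\<theta> * A) * sqnorm I c \<or> 3 / 2 * (\<theta> * B) * sqnorm I c < ?S c"
      using c \<theta> unfolding sub[OF j] by (auto simp: not_le mult_less_cancel_left_pos mult_ac)
    define q where "q = sqnorm I c"
    have "q \<noteq> 0"
    proof
      assume "q = 0"
      then have "ip I c v = 0" for v by (simp add: q_def sqnorm_eq_0[OF fin] ip_def)
      then show False using c' \<open>q = 0\<close> by (simp add: q_def)
    qed
    then have q: "0 < q" using sqnorm_nonneg[of I c] by (simp add: q_def)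
    define e where "e = (\<lambda>k. of_real (1 / sqrt q) * c k)"
    have "sqnorm I e = 1"
      unfolding e_def sqnorm_scale using q by (simp add: q_def norm_divide power_divide)
    moreover have "?S e = ?S c / q"
      unfolding e_def ip_scale_left using q
      by (simp add: norm_mult norm_divide power_divide power_mult_distrib sum_divide_distrib)
    then have "3 / 2 * (\<theta> * B) \<le> 1 * ?S e \<or> - (1 / 2) * (\<theta> * A) \<le> - 1 * ?S e"
      using c' q unfolding q_def[symmetric] by (auto simp: pos_le_divide_eq pos_divide_le_eq)
    ultimately show "j \<in> bad 1 (3 / 2 * (\<theta> * B)) \<union> bad (- 1) (- (1 / 2) * (\<theta> * A))"
      using j unfolding bad_def by blast
  qed
  then have "sum ?p ?bad \<le> sum ?p (bad 1 (3 / 2 * (\<theta> * B)) \<union> bad (- 1) (- (1 / 2) * (\<theta> * A)))"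
  proof (rule sum_mono2[rotated])
    show "0 \<le> ?p j" if "j \<in> bad 1 (3 / 2 * (\<theta> * B)) \<union> bad (- 1) (- (1 / 2) * (\<theta> * A)) - ?bad" for j
      using that by (intro p0) (auto simp: bad_def)
  qed (simp add: finb)
  also have "\<dots> \<le> sum ?p (bad 1 (3 / 2 * (\<theta> * B))) + sum ?p (bad (- 1) (- (1 / 2) * (\<theta> * A)))"
  proof -
    have "0 \<le> sum ?p (bad 1 (3 / 2 * (\<theta> * B)) \<inter> bad (- 1) (- (1 / 2) * (\<theta> * A)))"
      by (rule sum_nonneg, rule p0) (simp add: bad_def)
    then show ?thesis using sum_Un[OF finb finb, of ?p] by simp
  qed
  finally show ?thesis using upper lower by linarith
qed

theorem theorem3p1:
  fixes D :: "(real ^ 'd) set"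
    and \<nu> :: "(real ^ 'd) measure"
    and V :: "(real ^ 'd \<Rightarrow> complex) set"
    and I_MZ I :: "'k set"
    and \<eta> :: "'k \<Rightarrow> real ^ 'd \<Rightarrow> complex"
    and M n :: nat
    and x :: "nat \<Rightarrow> real ^ 'd"
    and \<omega> \<rho> :: "nat \<Rightarrow> real"
    and A B C t :: real
    and P :: "'w measure"
    and J :: "nat \<Rightarrow> 'w \<Rightarrow> nat"
  assumes "sigma_finite_measure \<nu>" and "space \<nu> = D"
    and "0 < C" and "C \<le> 1"
    and "finite_dim_L2_space \<nu> V"
    and "L2_orthonormal_basis \<nu> V I_MZ \<eta>"
    and "\<forall>i\<in>{1..M}. x i \<in> D"
    and "\<forall>i\<in>{1..M}. 0 \<le> \<omega> i"
    and "0 < A" and "A \<le> B"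
    and "L2_MZ_inequality \<nu> V M x \<omega> A B"
    and "0 < t"
    and "I \<noteq> {}" and "I \<subseteq> I_MZ"
    and "real n \<ge> 12 * B / (A * C) * real (card I) * (ln (real (card I)) + t)"
    and "\<forall>i\<in>{1..M}. 0 \<le> \<rho> i"
    and "(\<Sum>i=1..M. \<rho> i) = 1"
    and "\<forall>i\<in>{1..M}. \<rho> i \<ge> C * \<omega> i * (\<Sum>k\<in>I. (cmod (\<eta> k (x i)))\<^sup>2) /
                             (\<Sum>j=1..M. \<omega> j * (\<Sum>k\<in>I. (cmod (\<eta> k (x j)))\<^sup>2))"
    and "iid_indices P n M \<rho> J"
  shows "measure P {w \<in> space P. \<forall>f \<in> cfun.span (\<eta> ` I).
            1 / 2 * A * (L2_norm \<nu> f)\<^sup>2 \<le> subsampled_sum n x \<omega> \<rho> (\<lambda>l. J l w) f \<and>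
            subsampled_sum n x \<omega> \<rho> (\<lambda>l. J l w) f \<le> 3 / 2 * B * (L2_norm \<nu> f)\<^sup>2}
         > 1 - 2 * exp (- t)"
proof -
  note V = assms(5)[unfolded finite_dim_L2_space_def]
  note basis = assms(6)[unfolded L2_orthonormal_basis_def]
  interpret prob_space P using assms(19) by (simp add: iid_indices_def)
  have "finite (\<eta> ` I_MZ)"
  proof -
    obtain S where S: "finite S" "cfun.span S = V" using V by blast
    have "\<eta> ` I_MZ \<subseteq> cfun.span S"
      unfolding S(2) using basis by (blast intro: cfun.span_base)
    then show ?thesis
      using cfun.independent_span_bound[OF S(1)] basis by blast
  qed
  then have "finite I_MZ" using basis finite_imageD by blast
  then have fin: "finite I" using assms(14) finite_subset by blast
  have inj: "inj_on \<eta> I" using basis assms(14) inj_on_subset by blast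
  define comb where "comb = (\<lambda>c z. \<Sum>k\<in>I. c k * \<eta> k z)"
  have span: "cfun.span (\<eta> ` I) = range comb"
    unfolding comb_def by (rule span_image_lincomb[OF fin inj])
  have combV: "comb c \<in> V" for c
  proof -
    have "comb c \<in> cfun.span (\<eta> ` I)" unfolding span by simp
    then show ?thesis
      using cfun.span_mono[OF image_mono[OF assms(14)], of \<eta>] basis by blast
  qed
  have "\<eta> k \<in> V" if "k \<in> I" for k
    using basis that assms(14) by (blast intro: cfun.span_base)
  then have sq: "square_integrable \<nu> (\<eta> k)" if "k \<in> I" for k
    using V that by blast
  have "L2_inner \<nu> (\<eta> k) (\<eta> l) = (if k = l then 1 else 0)" if "k \<in> I" "l \<in> I" for k l
    using basis that assms(14) by blast
  then have norm: "(L2_norm \<nu> (comb c))\<^sup>2 = sqnorm I c" for c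
    unfolding comb_def by (intro L2_norm_lincomb fin sq) auto
  have n0: "0 < n"
  proof -
    have "1 \<le> real (card I)" using fin assms(13) by (simp add: Suc_le_eq card_gt_0_iff)
    then have "0 < 12 * B / (A * C) * real (card I) * (ln (real (card I)) + t)"
      using assms(3,9,10,12) by (intro mult_pos_pos divide_pos_pos add_nonneg_pos) auto
    then have "0 < real n" using assms(15) by linarith
    then show ?thesis by simp
  qed
  define good where "good = (\<lambda>j. \<forall>c. 1 / 2 * A * sqnorm I c \<le> subsampled_sum n x \<omega> \<rho> j (comb c) \<and>
      subsampled_sum n x \<omega> \<rho> j (comb c) \<le> 3 / 2 * B * sqnorm I c)"
  have good_cong: "good j \<longleftrightarrow> good j'" if "\<And>l. l \<in> {1..n} \<Longrightarrow> j l = j' l" for j j'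
  proof -
    have "subsampled_sum n x \<omega> \<rho> j f = subsampled_sum n x \<omega> \<rho> j' f" for f
      unfolding subsampled_sum_def by (intro sum.cong refl) (simp add: that)
    then show ?thesis by (simp add: good_def)
  qed
  let ?p = "\<lambda>j. \<Prod>l=1..n. \<rho> (j l)"
  have "sum ?p {j. j \<in> {1..n} \<rightarrow>\<^sub>E {1..M} \<and> \<not> good j} < 2 * exp (- t)"
    unfolding good_def comb_def
  proof (rule subsampling_failure_weight[OF fin assms(13,3,9,10,12)])
    show "A * sqnorm I c \<le> (\<Sum>i=1..M. \<omega> i * (cmod (\<Sum>k\<in>I. c k * \<eta> k (x i)))\<^sup>2)"
      and "(\<Sum>i=1..M. \<omega> i * (cmod (\<Sum>k\<in>I. c k * \<eta> k (x i)))\<^sup>2) \<le> B * sqnorm I c" for c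
      using assms(11) combV[of c] unfolding L2_MZ_inequality_def norm[symmetric] by (auto simp: comb_def)
  qed (use assms in auto)
  moreover have "sum ?p {j. j \<in> {1..n} \<rightarrow>\<^sub>E {1..M} \<and> good j}
      + sum ?p {j. j \<in> {1..n} \<rightarrow>\<^sub>E {1..M} \<and> \<not> good j} = 1"
  proof -
    have "1 = prob {w \<in> space P. True}" by (simp add: prob_space)
    also have "\<dots> = sum ?p {j. j \<in> {1..n} \<rightarrow>\<^sub>E {1..M} \<and> True}"
      by (rule measure_iid_indices[OF assms(19) n0]) simp
    also have "\<dots> = sum ?p ({j. j \<in> {1..n} \<rightarrow>\<^sub>E {1..M} \<and> good j} \<union> {j. j \<in> {1..n} \<rightarrow>\<^sub>E {1..M} \<and> \<not> good j})"
      by (intro arg_cong[where f="sum ?p"]) auto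
    also have "\<dots> = sum ?p {j. j \<in> {1..n} \<rightarrow>\<^sub>E {1..M} \<and> good j}
      + sum ?p {j. j \<in> {1..n} \<rightarrow>\<^sub>E {1..M} \<and> \<not> good j}"
    proof (rule sum.union_disjoint)
      have "finite ({1..n} \<rightarrow>\<^sub>E {1..M})" by (intro finite_PiE) auto
      then show "finite {j. j \<in> {1..n} \<rightarrow>\<^sub>E {1..M} \<and> good j}"
        and "finite {j. j \<in> {1..n} \<rightarrow>\<^sub>E {1..M} \<and> \<not> good j}"
        by (auto intro: finite_subset[rotated])
    qed auto
    finally show ?thesis by simp
  qed
  moreover have "prob {w \<in> space P. good (\<lambda>l. J l w)} = sum ?p {j. j \<in> {1..n} \<rightarrow>\<^sub>E {1..M} \<and> good j}"
    by (rule measure_iid_indices[OF assms(19) n0 good_cong])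
  moreover have "(\<forall>f \<in> cfun.span (\<eta> ` I).
            1 / 2 * A * (L2_norm \<nu> f)\<^sup>2 \<le> subsampled_sum n x \<omega> \<rho> j f \<and>
            subsampled_sum n x \<omega> \<rho> j f \<le> 3 / 2 * B * (L2_norm \<nu> f)\<^sup>2) \<longleftrightarrow> good j" for j
    unfolding span good_def by (simp add: norm)
  ultimately show ?thesis by simp
qed

end
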